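(* Let $R$ be a non-discrete irreducible, continuous ring, and equip its unit group $\mathrm{GL}(R)$ with the relative rank topology, i.e., the topology generated by the metric $(a,b)\mapsto \mathrm{rk}_R(a-b)$. Then the topological group $\mathrm{GL}(R)$ is whirly, i.e., for every continuous action of $\mathrm{GL}(R)$ on a compact Hausdorff space $X$ and every $\mathrm{GL}(R)$-invariant regular Borel probability measure $\mu$ on $X$, the support of $\mu$ is contained in the set of $\mathrm{GL}(R)$-fixed points in $X$.
   Context: Continuous geometry: a complete, complemented, modular lattice $L$ such that for every chain $C\subseteq L$ and every $x\in L$ one has $x\wedge\bigvee C=\bigvee\{x\wedge y\mid y\in C\}$ and $x\vee\bigwedge C=\bigwedge\{x\vee y\mid y\in C\}$. Continuous ring: a unital ring $R$ is (von Neumann) regular if for every $a\in R$ there is $b\in R$ with $aba=a$. For regular $R$, the set $\mathrm{L}(R)=\{aR\mid a\in R\}$ of principal right ideals, ordered by inclusion, is a complemented modular lattice. A continuous ring is a regular ring $R$ such that $\mathrm{L}(R)$ is a continuous geometry. A ring is irreducible if it has at least two elements and is not isomorphic to a direct product of two rings each having at least two elements (for regular rings, equivalently: the center is a field). Rank function: a rank function on a regular ring $R$ is a map $\rho\colon R\to[0,1]$ with $\rho(1)=1$; $\rho(ab)\le\min\{\rho(a),\rho(b)\}$ for all $a,b\in R$; $\rho(e+f)=\rho(e)+\rho(f)$ for all idempotents $e,f\in R$ with $ef=fe=0$; and $\rho(a)>0$ for all $a\in R\setminus\{0\}$. By a theorem of von Neumann, every irreducible, continuous ring $R$ has a unique rank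 function, denoted $\mathrm{rk}_R$. Then $d_R(a,b)=\mathrm{rk}_R(a-b)$ is a complete metric on $R$; the topology it generates is the rank topology. $R$ is called discrete if its rank topology is discrete, and non-discrete otherwise. $\mathrm{GL}(R)=\{a\in R\mid \exists b\in R\colon ab=ba=1\}$ denotes the unit group; $d_R$ restricts to a bi-invariant metric on it, so it is a topological group with the relative rank topology. A continuous action of a topological group $G$ on $X$ is an action such that $G\times X\to X$ is continuous. *)

theory Defs
  imports "HOL-Probability.Probability" "HOL-Algebra.Algebra"
begin

section \<open>Continuous geometries\<close>

locale continuous_geometry = complete_lattice L for L (structure) +
  assumes complemented:
    "x \<in> carrier L \<Longrightarrow> \<exists>y\<in>carrier L. x \<sqinter>\<^bsub>L\<^esub> y = \<bottom>\<^bsub>L\<^esub> \<and> x \<squnion>\<^bsub>L\<^esub> y = \<top>\<^bsub>L\<^esub>"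
  and modular:
    "\<lbrakk>x \<in> carrier L; y \<in> carrier L; z \<in> carrier L; x \<sqsubseteq>\<^bsub>L\<^esub> z\<rbrakk>
      \<Longrightarrow> x \<squnion>\<^bsub>L\<^esub> (y \<sqinter>\<^bsub>L\<^esub> z) = (x \<squnion>\<^bsub>L\<^esub> y) \<sqinter>\<^bsub>L\<^esub> z"
  and meet_continuous:
    "\<lbrakk>C \<subseteq> carrier L; \<forall>y\<in>C. \<forall>z\<in>C. y \<sqsubseteq>\<^bsub>L\<^esub> z \<or> z \<sqsubseteq>\<^bsub>L\<^esub> y; x \<in> carrier L\<rbrakk>
      \<Longrightarrow> x \<sqinter>\<^bsub>L\<^esub> (\<Squnion>\<^bsub>L\<^esub> C) = \<Squnion>\<^bsub>L\<^esub> ((\<lambda>y. x \<sqinter>\<^bsub>L\<^esub> y) ` C)"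
  and join_continuous:
    "\<lbrakk>C \<subseteq> carrier L; \<forall>y\<in>C. \<forall>z\<in>C. y \<sqsubseteq>\<^bsub>L\<^esub> z \<or> z \<sqsubseteq>\<^bsub>L\<^esub> y; x \<in> carrier L\<rbrakk>
      \<Longrightarrow> x \<squnion>\<^bsub>L\<^esub> (\<Sqinter>\<^bsub>L\<^esub> C) = \<Sqinter>\<^bsub>L\<^esub> ((\<lambda>y. x \<squnion>\<^bsub>L\<^esub> y) ` C)"


section \<open>Irreducible, continuous rings\<close>

definition regular_ring :: "('a, 'b) ring_scheme \<Rightarrow> bool" where
  "regular_ring R \<longleftrightarrow>
     ring R \<and> (\<forall>a\<in>carrier R. \<exists>b\<in>carrier R. a \<otimes>\<^bsub>R\<^esub> b \<otimes>\<^bsub>R\<^esub> a = a)"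

definition principal_right_ideals :: "('a, 'b) ring_scheme \<Rightarrow> 'a set gorder" where
  "principal_right_ideals R =
     \<lparr>carrier = {a <#\<^bsub>R\<^esub> carrier R | a. a \<in> carrier R}, eq = (=), le = (\<subseteq>)\<rparr>"

definition continuous_ring :: "('a, 'b) ring_scheme \<Rightarrow> bool" where
  "continuous_ring R \<longleftrightarrow>
     regular_ring R \<and> continuous_geometry (principal_right_ideals R)"

definition nontrivial_ring :: "('a, 'b) ring_scheme \<Rightarrow> bool" where
  "nontrivial_ring R \<longleftrightarrow> ring R \<and> (\<exists>x\<in>carrier R. \<exists>y\<in>carrier R. x \<noteq> y)"

text \<open>
  It suffices to let the factors \<open>S\<close> and \<open>T\<close> range over rings with elements in the type of
  the elements of \<open>R\<close>: if \<open>R\<close> is isomorphic to a product \<open>S \<times> T\<close> of rings over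
  any types, then \<open>S\<close> and \<open>T\<close> are isomorphic to the ideals \<open>eR\<close> and \<open>(1 - e)R\<close> of
  \<open>R\<close>, for the central idempotent \<open>e\<close> that corresponds to \<open>(1, 0)\<close>.
\<close>
definition irreducible_ring :: "('a, 'b) ring_scheme \<Rightarrow> bool" where
  "irreducible_ring R \<longleftrightarrow>
     nontrivial_ring R \<and>
     \<not> (\<exists>(S :: 'a ring) (T :: 'a ring).
           nontrivial_ring S \<and> nontrivial_ring T \<and> R \<simeq> RDirProd S T)"


section \<open>Rank functions and the rank topology\<close>

text \<open>
  By a theorem of von Neumann, an irreducible, continuous ring has exactly one rank function, up to
  the irrelevant values outside the carrier. The notions below therefore take the rank
  function as a parameter.
\<close>
definition rank_function :: "('a, 'b) ring_scheme \<Rightarrow> ('a \<Rightarrow> real) \<Rightarrow> bool" where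
  "rank_function R \<rho> \<longleftrightarrow>
     \<rho> \<in> carrier R \<rightarrow> {0..1} \<and>
     \<rho> \<one>\<^bsub>R\<^esub> = 1 \<and>
     (\<forall>a\<in>carrier R. \<forall>b\<in>carrier R. \<rho> (a \<otimes>\<^bsub>R\<^esub> b) \<le> min (\<rho> a) (\<rho> b)) \<and>
     (\<forall>e\<in>carrier R. \<forall>f\<in>carrier R.
        e \<otimes>\<^bsub>R\<^esub> e = e \<and> f \<otimes>\<^bsub>R\<^esub> f = f \<and> e \<otimes>\<^bsub>R\<^esub> f = \<zero>\<^bsub>R\<^esub> \<and> f \<otimes>\<^bsub>R\<^esub> e = \<zero>\<^bsub>R\<^esub>
        \<longrightarrow> \<rho> (e \<oplus>\<^bsub>R\<^esub> f) = \<rho> e + \<rho> f) \<and>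
     (\<forall>a\<in>carrier R - {\<zero>\<^bsub>R\<^esub>}. \<rho> a > 0)"

text \<open>
  The locale \<open>Metric_space\<close> requires its distance function to be symmetric and nonnegative on
  the whole type; hence the default value outside the carrier.
\<close>
definition rank_dist :: "('a, 'b) ring_scheme \<Rightarrow> ('a \<Rightarrow> real) \<Rightarrow> 'a \<Rightarrow> 'a \<Rightarrow> real" where
  "rank_dist R \<rho> a b = (if a \<in> carrier R \<and> b \<in> carrier R then \<rho> (a \<ominus>\<^bsub>R\<^esub> b) else 0)"

definition rank_topology :: "('a, 'b) ring_scheme \<Rightarrow> ('a \<Rightarrow> real) \<Rightarrow> 'a topology" where
  "rank_topology R \<rho> = Metric_space.mtopology (carrier R) (rank_dist R \<rho>)"

definition rank_discrete :: "('a, 'b) ring_scheme \<Rightarrow> ('a \<Rightarrow> real) \<Rightarrow> bool" where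
  "rank_discrete R \<rho> \<longleftrightarrow> rank_topology R \<rho> = discrete_topology (carrier R)"

definition GL_topology :: "('a, 'b) ring_scheme \<Rightarrow> ('a \<Rightarrow> real) \<Rightarrow> 'a topology" where
  "GL_topology R \<rho> = subtopology (rank_topology R \<rho>) (Units R)"


section \<open>Continuous actions and invariant measures\<close>

definition continuous_action ::
    "('a, 'b) monoid_scheme \<Rightarrow> 'a topology \<Rightarrow> ('a \<Rightarrow> 'x::topological_space \<Rightarrow> 'x) \<Rightarrow> bool" where
  "continuous_action G T \<phi> \<longleftrightarrow>
     group_action G UNIV \<phi> \<and>
     continuous_map (prod_topology T euclidean) euclidean (\<lambda>(g, x). \<phi> g x)"

definition fixed_points :: "('a, 'b) monoid_scheme \<Rightarrow> ('a \<Rightarrow> 'x \<Rightarrow> 'x) \<Rightarrow> 'x set" where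
  "fixed_points G \<phi> = {x. \<forall>g\<in>carrier G. \<phi> g x = x}"

definition regular_borel_prob :: "'x::topological_space measure \<Rightarrow> bool" where
  "regular_borel_prob M \<longleftrightarrow>
     sets M = sets borel \<and> prob_space M \<and>
     (\<forall>B\<in>sets borel.
        emeasure M B = (SUP K\<in>{K. K \<subseteq> B \<and> compact K}. emeasure M K) \<and>
        emeasure M B = (INF U\<in>{U. B \<subseteq> U \<and> open U}. emeasure M U))"

definition invariant_measure ::
    "('a, 'b) monoid_scheme \<Rightarrow> ('a \<Rightarrow> 'x \<Rightarrow> 'x) \<Rightarrow> 'x measure \<Rightarrow> bool" where
  "invariant_measure G \<phi> M \<longleftrightarrow>
     (\<forall>g\<in>carrier G. \<phi> g \<in> measurable M M \<and> distr M M (\<phi> g) = M)"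

definition measure_support :: "'x::topological_space measure \<Rightarrow> 'x set" where
  "measure_support M = {x. \<forall>U. open U \<and> x \<in> U \<longrightarrow> emeasure M U > 0}"

end

theory Submission
  imports Defs
begin

text \<open>
  An element \<open>t = 1 - ye\<close> with \<open>e\<close> idempotent and \<open>eye = 2e\<close> is an involution. Since the ring is
  non-discrete, \<open>e\<close> is a sum of orthogonal idempotents \<open>e\<^sub>1, \<dots>, e\<^sub>n\<close> of rank at most \<open>\<delta>\<close>, so that
  \<open>t\<close> is the product of the commuting involutions \<open>1 - y e\<^sub>i\<close>. For commuting measure preserving
  involutions, the energy \<open>D(u) = \<integral>(F(ux) - F x)\<^sup>2 d\<mu>\<close> is subadditive; if \<open>F\<close> is \<open>L\<close>-Lipschitz
  along orbits, then \<open>D(t) \<le> L\<^sup>2 \<Sum> rk(e\<^sub>i)\<^sup>2 \<le> L\<^sup>2 \<delta>\<close>, whence \<open>D(t) = 0\<close>. As continuous functions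
  are uniform limits of such \<open>F\<close>, the involution \<open>t\<close> fixes the support of \<open>\<mu>\<close> pointwise.

  Every unipotent \<open>1 + x\<close> with \<open>x\<^sup>2 = 0\<close> is a product of two such involutions, and Gaussian
  elimination in small steps shows that the unipotents generate a dense subgroup of the unit group.
  Splitting and elimination rest on the comparability of idempotents by rank, which follows from
  Zorn's lemma and the continuity of the lattice, applied to graphs of partial isomorphisms.
\<close>

section \<open>Regular rings with a rank function\<close>

locale rank_ring = ring R for R (structure) +
  fixes rk :: "'a \<Rightarrow> real"
  assumes regular: "a \<in> carrier R \<Longrightarrow> \<exists>b\<in>carrier R. a \<otimes> b \<otimes> a = a"
    and rank_function: "rank_function R rk"
begin

definition idem :: "'a \<Rightarrow> bool" where
  "idem e \<longleftrightarrow> e \<in> carrier R \<and> e \<otimes> e = e"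

lemma idemD [dest]: "idem e \<Longrightarrow> e \<in> carrier R" "idem e \<Longrightarrow> e \<otimes> e = e"
  by (auto simp: idem_def)

text \<open>Products are normalised to nest to the right, where \<open>x \<otimes> y\<close> is no
  longer a subterm; in this form the equation still rewrites there.\<close>

lemma mult_rewrite:
  "\<lbrakk>x \<otimes> y = z; x \<in> carrier R; y \<in> carrier R; w \<in> carrier R\<rbrakk> \<Longrightarrow> x \<otimes> (y \<otimes> w) = z \<otimes> w"
  using m_assoc by metis

lemma add_cancel [simp]:
  "\<lbrakk>x \<in> carrier R; y \<in> carrier R\<rbrakk> \<Longrightarrow> x \<oplus> (y \<oplus> \<ominus> x) = y"
  "\<lbrakk>x \<in> carrier R; y \<in> carrier R\<rbrakk> \<Longrightarrow> \<ominus> x \<oplus> (y \<oplus> x) = y"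
  using a_lcomm[of x y "\<ominus> x"] a_lcomm[of "\<ominus> x" y x] by (simp_all add: r_neg l_neg)

lemma add_minus_eq_0_iff:
  "\<lbrakk>x \<in> carrier R; y \<in> carrier R\<rbrakk> \<Longrightarrow> x \<oplus> \<ominus> y = \<zero> \<longleftrightarrow> x = y"
  "\<lbrakk>x \<in> carrier R; y \<in> carrier R\<rbrakk> \<Longrightarrow> \<ominus> y \<oplus> x = \<zero> \<longleftrightarrow> x = y"
  using r_right_minus_eq[of x y] by (simp_all add: minus_eq a_comm)

lemmas expand = l_distr r_distr minus_eq m_assoc l_minus r_minus a_assoc a_lcomm a_comm
  minus_add r_neg r_neg1 r_neg2 l_neg

lemma regularE:
  assumes "a \<in> carrier R"
  obtains b where "b \<in> carrier R" "a \<otimes> b \<otimes> a = a"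
  using regular assms by blast

lemma idem_compl:
  assumes "idem e"
  shows "idem (\<one> \<ominus> e)" "(\<one> \<ominus> e) \<otimes> e = \<zero>" "e \<otimes> (\<one> \<ominus> e) = \<zero>"
proof -
  have [simp]: "e \<in> carrier R" "e \<otimes> e = e" using assms by auto
  show "idem (\<one> \<ominus> e)" "(\<one> \<ominus> e) \<otimes> e = \<zero>" "e \<otimes> (\<one> \<ominus> e) = \<zero>"
    by (simp_all add: idem_def expand)
qed

section \<open>Elementary properties of the rank\<close>

lemma rk_nonneg: "a \<in> carrier R \<Longrightarrow> 0 \<le> rk a"
  and rk_le_1: "a \<in> carrier R \<Longrightarrow> rk a \<le> 1"
  and rk_one: "rk \<one> = 1"
  and rk_mult_left: "\<lbrakk>a \<in> carrier R; b \<in> carrier R\<rbrakk> \<Longrightarrow> rk (a \<otimes> b) \<le> rk a"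
  and rk_mult_right: "\<lbrakk>a \<in> carrier R; b \<in> carrier R\<rbrakk> \<Longrightarrow> rk (a \<otimes> b) \<le> rk b"
  and rk_orthogonal: "\<lbrakk>idem e; idem f; e \<otimes> f = \<zero>; f \<otimes> e = \<zero>\<rbrakk> \<Longrightarrow> rk (e \<oplus> f) = rk e + rk f"
  and rk_pos: "\<lbrakk>a \<in> carrier R; a \<noteq> \<zero>\<rbrakk> \<Longrightarrow> 0 < rk a"
  using rank_function unfolding rank_function_def idem_def by (auto simp: Pi_iff)

lemma rk_zero: "rk \<zero> = 0"
  using rk_orthogonal[of \<zero> \<zero>] by (simp add: idem_def)

lemma rk_eq_0_iff: "a \<in> carrier R \<Longrightarrow> rk a = 0 \<longleftrightarrow> a = \<zero>"
  using rk_pos rk_zero by fastforce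

lemma rk_compl: "idem e \<Longrightarrow> rk (\<one> \<ominus> e) = 1 - rk e"
proof -
  assume e: "idem e"
  have "e \<oplus> (\<one> \<ominus> e) = \<one>" using idemD(1)[OF e] by (simp add: expand)
  then show ?thesis
    using rk_orthogonal[OF e idem_compl(1)[OF e]] idem_compl(2,3)[OF e] rk_one by auto
qed

text \<open>The idempotent \<open>w\<close> generates \<open>eR + bR\<close>: it is \<open>e\<close>
  plus an idempotent generator \<open>k\<close> of \<open>(1 - e)bR\<close> that is orthogonal to
  \<open>e\<close>, whence the bound on its rank.\<close>

lemma idem_join:
  assumes e: "idem e" and b: "b \<in> carrier R"
  obtains w where "idem w" "w \<otimes> e = e" "w \<otimes> b = b" "rk w \<le> rk e + rk b"
    "\<exists>m\<in>carrier R. \<exists>n\<in>carrier R. w = e \<otimes> m \<oplus> b \<otimes> n"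
proof -
  have [simp]: "e \<in> carrier R" "e \<otimes> e = e" "b \<in> carrier R" using assms by auto
  define c where "c = (\<one> \<ominus> e) \<otimes> b"
  have c [simp]: "c \<in> carrier R" "e \<otimes> c = \<zero>"
    by (simp_all add: c_def expand mult_rewrite[of e e e])
  obtain y where y [simp]: "y \<in> carrier R" "c \<otimes> y \<otimes> c = c" using regularE c(1) .
  \<comment> \<open>\<open>c \<otimes> y\<close> is already idempotent with image \<open>cR\<close>;
    the factor \<open>\<one> \<ominus> e\<close> makes it vanish on \<open>e\<close> as
    well.\<close>
  define k where "k = c \<otimes> y \<otimes> (\<one> \<ominus> e)"
  have k [simp]: "k \<in> carrier R" by (simp add: k_def)
  have ke: "k \<otimes> e = \<zero>" by (simp add: k_def expand)
  have ek: "e \<otimes> k = \<zero>" by (simp add: k_def m_assoc mult_rewrite[OF c(2)])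
  have kc: "k \<otimes> c = c" by (simp add: k_def m_assoc[of _ _ c]) (simp add: minus_eq l_distr l_minus)
  have "k \<otimes> k = (k \<otimes> c) \<otimes> (y \<otimes> (\<one> \<ominus> e))" by (simp add: k_def m_assoc)
  then have kk: "idem k" by (simp add: idem_def kc) (simp add: k_def m_assoc)
  have "k \<otimes> b = k \<otimes> c" by (simp add: c_def expand mult_rewrite[OF ke])
  then have kb: "k \<otimes> b = c" by (simp add: kc)
  define w where "w = e \<oplus> k"
  have "idem w" using kk by (simp add: w_def idem_def expand ke ek)
  moreover have "w \<otimes> e = e" by (simp add: w_def l_distr ke)
  moreover have "w \<otimes> b = b" by (simp add: w_def l_distr kb) (simp add: c_def expand)
  moreover have "rk k \<le> rk b"
    using rk_mult_left[of c "y \<otimes> (\<one> \<ominus> e)"] rk_mult_right[of "\<one> \<ominus> e" b]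
    by (simp add: k_def c_def m_assoc)
  then have "rk w \<le> rk e + rk b" using rk_orthogonal[OF e kk ek ke] by (simp add: w_def)
  moreover have "w = e \<otimes> (\<one> \<ominus> b \<otimes> y \<otimes> (\<one> \<ominus> e)) \<oplus> b \<otimes> (y \<otimes> (\<one> \<ominus> e))"
    by (simp add: w_def k_def c_def r_distr[of _ _ e] l_distr minus_eq r_minus l_minus m_assoc a_assoc a_comm a_lcomm)
  then have "\<exists>m\<in>carrier R. \<exists>n\<in>carrier R. w = e \<otimes> m \<oplus> b \<otimes> n"
    by (metis m_closed minus_closed one_closed \<open>e \<in> carrier R\<close> \<open>b \<in> carrier R\<close> y(1))
  ultimately show ?thesis by (rule that)
qed

lemma idem_image:
  assumes "a \<in> carrier R"
  obtains e b where "idem e" "b \<in> carrier R" "e = a \<otimes> b" "e \<otimes> a = a" "rk e = rk a"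
proof -
  note [simp] = assms
  obtain b where b [simp]: "b \<in> carrier R" "a \<otimes> b \<otimes> a = a" using regularE assms .
  have "idem (a \<otimes> b)" by (simp add: idem_def m_assoc[symmetric])
  moreover have "rk (a \<otimes> b) = rk a"
    using rk_mult_left[of a b] rk_mult_left[of "a \<otimes> b" a] by simp
  ultimately show ?thesis using that b by blast
qed

text \<open>The axioms give additivity for orthogonal idempotents only. An idempotent
  \<open>w\<close> from \<open>idem_join\<close> that fixes \<open>a\<close> and \<open>b\<close>
  from the left also fixes their sum.\<close>

lemma rk_add:
  assumes "a \<in> carrier R" "b \<in> carrier R"
  shows "rk (a \<oplus> b) \<le> rk a + rk b"
proof -
  note [simp] = assms
  obtain e c where e: "idem e" "e \<otimes> a = a" "rk e = rk a" using idem_image assms(1) by metis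
  obtain w where w: "idem w" "w \<otimes> e = e" "w \<otimes> b = b" "rk w \<le> rk e + rk b"
    using idem_join[OF e(1) assms(2)] by blast
  have [simp]: "e \<in> carrier R" "w \<in> carrier R" using e w by auto
  have "w \<otimes> a = a" using w(2) e(2) m_assoc[of w e a] by simp
  then have "w \<otimes> (a \<oplus> b) = a \<oplus> b" by (simp add: r_distr w)
  then show ?thesis using rk_mult_left[of w "a \<oplus> b"] w e by simp
qed

lemma rk_minus: "a \<in> carrier R \<Longrightarrow> rk (\<ominus> a) = rk a"
proof -
  have "rk (\<ominus> b) \<le> rk b" if "b \<in> carrier R" for b
    using rk_mult_right[of "\<ominus> \<one>" b] that by (simp add: l_minus)
  from this[of a] this[of "\<ominus> a"] show "a \<in> carrier R \<Longrightarrow> rk (\<ominus> a) = rk a" by simp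
qed

sublocale rank: Metric_space "carrier R" "rank_dist R rk"
proof
  fix x y z
  show "0 \<le> rank_dist R rk x y" by (auto simp: rank_dist_def rk_nonneg)
  have "\<ominus> (x \<ominus> y) = y \<ominus> x" if "x \<in> carrier R" "y \<in> carrier R"
    using that by (simp add: minus_eq minus_add a_comm)
  then show "rank_dist R rk x y = rank_dist R rk y x"
    using rk_minus[of "x \<ominus> y"] by (auto simp: rank_dist_def)
  assume [simp]: "x \<in> carrier R" "y \<in> carrier R"
  show "rank_dist R rk x y = 0 \<longleftrightarrow> x = y"
    by (simp add: rank_dist_def rk_eq_0_iff)
  assume [simp]: "z \<in> carrier R"
  have "x \<ominus> z = (x \<ominus> y) \<oplus> (y \<ominus> z)" by (simp add: expand)
  then show "rank_dist R rk x z \<le> rank_dist R rk x y + rank_dist R rk y z"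
    using rk_add[of "x \<ominus> y" "y \<ominus> z"] by (simp add: rank_dist_def)
qed

text \<open>An element of \<open>eR\<close> of full rank generates \<open>eR\<close>: the difference
  of \<open>e\<close> and an idempotent generator below \<open>e\<close> has rank 0.\<close>

lemma rk_eq_imp_absorb:
  assumes "idem e" "a \<in> carrier R" "e \<otimes> a = a" "rk e \<le> rk a"
  obtains w where "w \<in> carrier R" "a \<otimes> w = e"
proof -
  note [simp] = assms(2,3)
  have [simp]: "e \<in> carrier R" "e \<otimes> e = e" using assms by auto
  obtain q b where q: "idem q" "b \<in> carrier R" "q = a \<otimes> b" "q \<otimes> a = a" "rk q = rk a"
    using idem_image assms(2) .
  have eq: "e \<otimes> q = q" using q by (simp add: mult_rewrite[OF assms(3)] m_assoc[symmetric])
  have [simp]: "q \<in> carrier R" "q \<otimes> q = q" using q by auto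
  \<comment> \<open>\<open>q'\<close> generates the same right ideal as \<open>q\<close>, but lies below \<open>e\<close>.\<close>
  define q' where "q' = q \<otimes> e"
  have [simp]: "q' \<in> carrier R" by (simp add: q'_def)
  have q': "idem q'" "e \<otimes> q' = q'" "q' \<otimes> e = q'" "q' \<otimes> q = q"
    by (simp_all add: q'_def idem_def m_assoc mult_rewrite[OF eq] eq mult_rewrite[OF \<open>q \<otimes> q = q\<close>])
  then have "rk q \<le> rk q'" using rk_mult_left[of q' q] by simp
  have [simp]: "q' \<otimes> q' = q'" using q' by auto
  have "idem (e \<ominus> q')" "q' \<otimes> (e \<ominus> q') = \<zero>" "(e \<ominus> q') \<otimes> q' = \<zero>" "q' \<oplus> (e \<ominus> q') = e"
    by (simp_all add: idem_def expand q')
  then have "rk e = rk q' + rk (e \<ominus> q')" using rk_orthogonal[OF q'(1)] by metis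
  then have "rk (e \<ominus> q') = 0"
    using \<open>rk q \<le> rk q'\<close> q(5) assms(4) rk_nonneg[of "e \<ominus> q'"] by simp
  then have "e = q'" by (simp add: rk_eq_0_iff)
  then have "a \<otimes> (b \<otimes> e) = e" using q by (simp add: q'_def m_assoc)
  then show ?thesis using that q by (meson m_closed \<open>e \<in> carrier R\<close>)
qed

section \<open>Involutions that split along idempotents\<close>

text \<open>
  In the form \<open>1 - ye\<close> with \<open>eye = 2e\<close>, an involution splits along every decomposition of \<open>e\<close>
  into orthogonal idempotents, in any characteristic.
\<close>
lemma split_involution:
  assumes e: "idem e" and y: "y \<in> carrier R" and eye: "e \<otimes> y \<otimes> e = e \<oplus> e"
  shows "(\<one> \<ominus> y \<otimes> e) \<otimes> (\<one> \<ominus> y \<otimes> e) = \<one>" "\<one> \<ominus> y \<otimes> e \<in> Units R"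
    "rk (\<one> \<ominus> y \<otimes> e \<ominus> \<one>) \<le> rk e"
proof -
  have [simp]: "e \<in> carrier R" "y \<in> carrier R" using e y by auto
  define z where "z = y \<otimes> e"
  have [simp]: "z \<in> carrier R" by (simp add: z_def)
  have zz: "z \<otimes> z = z \<oplus> z"
  proof -
    have "z \<otimes> z = y \<otimes> (e \<otimes> y \<otimes> e)" by (simp add: z_def m_assoc)
    then show ?thesis by (simp add: eye) (simp add: z_def r_distr)
  qed
  show inv: "(\<one> \<ominus> y \<otimes> e) \<otimes> (\<one> \<ominus> y \<otimes> e) = \<one>"
    unfolding z_def[symmetric] by (simp add: expand zz)
  then show "\<one> \<ominus> y \<otimes> e \<in> Units R" by (auto simp: Units_def)
  have "\<one> \<ominus> y \<otimes> e \<ominus> \<one> = \<ominus> z" by (simp add: expand z_def)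
  then show "rk (\<one> \<ominus> y \<otimes> e \<ominus> \<one>) \<le> rk e" using rk_minus[of z] rk_mult_right[of y e] by (simp add: z_def)
qed

text \<open>Cutting \<open>(d + e)y(d + e) = 2(d + e)\<close> down by \<open>d\<close> and
  \<open>e\<close> on either side gives the two diagonal equations and \<open>dye = eyd = 0\<close>,
  so the cross terms of the products vanish.\<close>

lemma split_involution_add:
  assumes de: "idem d" "idem e" and y: "y \<in> carrier R"
    and orth: "d \<otimes> e = \<zero>" "e \<otimes> d = \<zero>" and eye: "(d \<oplus> e) \<otimes> y \<otimes> (d \<oplus> e) = (d \<oplus> e) \<oplus> (d \<oplus> e)"
  shows "d \<otimes> y \<otimes> d = d \<oplus> d" "e \<otimes> y \<otimes> e = e \<oplus> e"
    "(\<one> \<ominus> y \<otimes> d) \<otimes> (\<one> \<ominus> y \<otimes> e) = \<one> \<ominus> y \<otimes> (d \<oplus> e)"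
    "(\<one> \<ominus> y \<otimes> e) \<otimes> (\<one> \<ominus> y \<otimes> d) = \<one> \<ominus> y \<otimes> (d \<oplus> e)"
proof -
  have [simp]: "d \<in> carrier R" "d \<otimes> d = d" "e \<in> carrier R" "e \<otimes> e = e" "y \<in> carrier R" using de y by auto
  have sandwich: "b \<otimes> y \<otimes> c = b \<otimes> c \<oplus> b \<otimes> c"
    if "b \<in> carrier R" "c \<in> carrier R" "b \<otimes> (d \<oplus> e) = b" "(d \<oplus> e) \<otimes> c = c" for b c
  proof -
    have "b \<otimes> y \<otimes> c = (b \<otimes> (d \<oplus> e)) \<otimes> y \<otimes> ((d \<oplus> e) \<otimes> c)" using that by simp
    also have "\<dots> = b \<otimes> ((d \<oplus> e) \<otimes> y \<otimes> (d \<oplus> e)) \<otimes> c"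
      using that(1,2) m_assoc by (metis \<open>d \<in> carrier R\<close> \<open>e \<in> carrier R\<close> \<open>y \<in> carrier R\<close> add.m_closed m_closed)
    also have "\<dots> = b \<otimes> ((d \<oplus> e) \<oplus> (d \<oplus> e)) \<otimes> c" by (simp only: eye)
    also have "\<dots> = (b \<otimes> (d \<oplus> e)) \<otimes> c \<oplus> (b \<otimes> (d \<oplus> e)) \<otimes> c"
      using that(1,2) by (simp add: l_distr r_distr)
    finally show ?thesis using that by simp
  qed
  have absorb: "d \<otimes> (d \<oplus> e) = d" "(d \<oplus> e) \<otimes> d = d" "e \<otimes> (d \<oplus> e) = e" "(d \<oplus> e) \<otimes> e = e"
    by (simp_all add: l_distr r_distr orth)
  show "d \<otimes> y \<otimes> d = d \<oplus> d" "e \<otimes> y \<otimes> e = e \<oplus> e"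
    using sandwich[of d d] sandwich[of e e] absorb by simp_all
  have "d \<otimes> (y \<otimes> e) = \<zero>" "e \<otimes> (y \<otimes> d) = \<zero>"
    using sandwich[of d e] sandwich[of e d] absorb orth by (simp_all add: m_assoc)
  then show "(\<one> \<ominus> y \<otimes> d) \<otimes> (\<one> \<ominus> y \<otimes> e) = \<one> \<ominus> y \<otimes> (d \<oplus> e)"
    "(\<one> \<ominus> y \<otimes> e) \<otimes> (\<one> \<ominus> y \<otimes> d) = \<one> \<ominus> y \<otimes> (d \<oplus> e)"
    by (simp_all add: expand)
qed

end

section \<open>Primeness and comparability\<close>

locale irreducible_continuous_rank_ring = rank_ring +
  assumes irreducible: "irreducible_ring R"
    and continuous: "continuous_ring R"
begin

sublocale lat: continuous_geometry "principal_right_ideals R"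
  using continuous unfolding continuous_ring_def by blast

lemma le_iff [simp]: "le (principal_right_ideals R) = (\<subseteq>)"
  by (simp add: principal_right_ideals_def)

abbreviation principal :: "'a \<Rightarrow> 'a set" where
  "principal a \<equiv> l_coset R a (carrier R)"

lemma mem_principal: "x \<in> principal a \<longleftrightarrow> (\<exists>r\<in>carrier R. x = a \<otimes> r)"
  by (auto simp: l_coset_def)

lemma principal_closed: "a \<in> carrier R \<Longrightarrow> principal a \<in> carrier (principal_right_ideals R)"
  by (auto simp: principal_right_ideals_def)

lemma mem_principal_idem:
  assumes "idem e"
  shows "x \<in> principal e \<longleftrightarrow> x \<in> carrier R \<and> e \<otimes> x = x"
proof -
  have "e \<in> carrier R" "e \<otimes> e = e" using assms by auto
  then show ?thesis by (auto simp: mem_principal mult_rewrite intro: sym)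
qed

lemma principal_subset_idem:
  assumes "a \<in> carrier R" "idem u" "u \<otimes> a = a"
  shows "principal a \<subseteq> principal u"
  using assms by (auto simp: mem_principal_idem mem_principal[of _ a] mult_rewrite idemD(1))

lemma principal_eq_idem:
  assumes "B \<in> carrier (principal_right_ideals R)"
  obtains e where "idem e" "B = principal e"
proof -
  obtain a where a: "a \<in> carrier R" "B = principal a"
    using assms by (auto simp: principal_right_ideals_def)
  obtain e b where e: "idem e" "b \<in> carrier R" "e = a \<otimes> b" "e \<otimes> a = a"
    using idem_image a(1) by blast
  then have "B = principal e"
    using a by (auto simp: mem_principal_idem mem_principal[of _ a] mult_rewrite idem_def)
      (metis m_assoc m_closed)
  then show ?thesis using that e by blast
qed

section \<open>Annihilators, central idempotents and primeness\<close>

lemma annihilator: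
  assumes "y \<in> carrier R"
  obtains u where "idem u" "y \<otimes> u = \<zero>" "\<forall>x\<in>carrier R. y \<otimes> x = \<zero> \<longrightarrow> u \<otimes> x = x"
proof -
  obtain b where b: "b \<in> carrier R" "y \<otimes> b \<otimes> y = y" using regularE assms .
  note [simp] = assms b(1)
  have yby: "y \<otimes> (b \<otimes> y) = y" using b by (simp add: m_assoc)
  define u where "u = \<one> \<ominus> b \<otimes> y"
  have "idem (b \<otimes> y)" by (simp add: idem_def m_assoc yby)
  then have "idem u" unfolding u_def by (rule idem_compl)
  moreover have "y \<otimes> u = \<zero>" by (simp add: u_def expand yby)
  moreover have "u \<otimes> x = x" if "x \<in> carrier R" "y \<otimes> x = \<zero>" for x
    using that by (simp add: u_def expand)
  ultimately show ?thesis using that by blast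
qed

text \<open>A central idempotent decomposes \<open>R\<close> as the product of \<open>eR\<close> and
  \<open>(1 - e)R\<close>, contrary to irreducibility if both are nonzero.\<close>

lemma central_idem:
  assumes e: "idem e" and central: "\<And>r. r \<in> carrier R \<Longrightarrow> e \<otimes> r = r \<otimes> e"
  shows "e = \<zero> \<or> e = \<one>"
proof (rule ccontr)
  assume ne: "\<not> ?thesis"
  \<comment> \<open>The ring \<open>cR\<close> with unit \<open>c\<close>. It keeps the element type
    of \<open>R\<close>, like the factors in \<open>irreducible_ring\<close>.\<close>
  define corner :: "'a \<Rightarrow> 'a ring" where
    "corner c = \<lparr>carrier = {x \<in> carrier R. c \<otimes> x = x}, monoid.mult = mult R, monoid.one = c,
      ring.zero = \<zero>, ring.add = add R\<rparr>" for c
  have nontriv: "nontrivial_ring (corner c)"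
    if c: "idem c" "\<And>r. r \<in> carrier R \<Longrightarrow> c \<otimes> r = r \<otimes> c" "c \<noteq> \<zero>" for c
  proof -
    have [simp]: "c \<in> carrier R" "c \<otimes> c = c" using c by auto
    have "c \<otimes> \<ominus> x = \<ominus> x \<and> \<ominus> x \<oplus> x = \<zero>" if "x \<in> carrier R" "c \<otimes> x = x" for x
      using that by (simp add: r_minus l_neg)
    then have "ring (corner c)"
      by (intro ringI abelian_groupI monoidI)
         (auto simp: corner_def a_ac m_assoc r_distr l_distr c(2)[symmetric]
               simp flip: m_assoc intro!: bexI[of _ "\<ominus> _"])
    moreover have "\<zero> \<in> carrier (corner c)" "c \<in> carrier (corner c)" by (auto simp: corner_def)
    ultimately show ?thesis using c(3) unfolding nontrivial_ring_def by metis
  qed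
  define f where "f = \<one> \<ominus> e"
  have f: "idem f" "f \<otimes> e = \<zero>" "e \<otimes> f = \<zero>" using idem_compl[OF e] by (auto simp: f_def)
  have [simp]: "e \<in> carrier R" "e \<otimes> e = e" "f \<in> carrier R" "f \<otimes> f = f" using e f by auto
  have fc: "f \<otimes> r = r \<otimes> f" if "r \<in> carrier R" for r
    using that by (simp add: f_def expand central)
  have ef1: "e \<oplus> f = \<one>" by (simp add: f_def expand)
  have "f \<noteq> \<zero>" using ne by (auto simp: f_def)
  have comm: "e \<otimes> (x \<otimes> (e \<otimes> y)) = e \<otimes> (x \<otimes> y)" "f \<otimes> (x \<otimes> (f \<otimes> y)) = f \<otimes> (x \<otimes> y)"
    if "x \<in> carrier R" "y \<in> carrier R" for x y
    using that by (simp_all add: central fc m_assoc)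
  have "(\<lambda>x. (e \<otimes> x, f \<otimes> x)) \<in> ring_iso R (RDirProd (corner e) (corner f))"
  proof (rule ring_iso_memI)
    have sum: "e \<otimes> x \<oplus> f \<otimes> x = x" if "x \<in> carrier R" for x
      using that ef1 l_distr[of e f x] by simp
    have "inj_on (\<lambda>x. (e \<otimes> x, f \<otimes> x)) (carrier R)"
      by (rule inj_onI) (metis sum prod.inject)
    moreover have "(x, y) \<in> (\<lambda>x. (e \<otimes> x, f \<otimes> x)) ` carrier R"
      if "x \<in> carrier R" "e \<otimes> x = x" "y \<in> carrier R" "f \<otimes> y = y" for x y
    proof -
      have "e \<otimes> y = \<zero>" "f \<otimes> x = \<zero>"
        using that mult_rewrite[OF f(3), of y] mult_rewrite[OF f(2), of x] by auto
      then have "(x, y) = (e \<otimes> (x \<oplus> y), f \<otimes> (x \<oplus> y))" using that by (simp add: r_distr)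
      then show ?thesis using that by blast
    qed
    ultimately show "bij_betw (\<lambda>x. (e \<otimes> x, f \<otimes> x)) (carrier R) (carrier (RDirProd (corner e) (corner f)))"
      by (auto simp: bij_betw_def RDirProd_carrier corner_def m_assoc[symmetric])
  qed (auto simp: RDirProd_def DirProd_def monoid.defs corner_def m_assoc r_distr comm
         mult_rewrite[of e e e] mult_rewrite[of f f f])
  then have "R \<simeq> RDirProd (corner e) (corner f)" unfolding is_ring_iso_def by blast
  then show False
    using irreducible nontriv[OF e central] nontriv[OF f(1) fc] ne \<open>f \<noteq> \<zero>\<close>
    unfolding irreducible_ring_def by blast
qed

text \<open>
  The supremum \<open>eR\<close> of the principal right ideals inside a left ideal \<open>I\<close> is two-sided, since
  right annihilators of elements are principal; as the ring is semiprime, \<open>e\<close> is central.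
\<close>
lemma ideal_generator:
  assumes I: "I \<subseteq> carrier R" "\<And>r x. \<lbrakk>r \<in> carrier R; x \<in> I\<rbrakk> \<Longrightarrow> r \<otimes> x \<in> I"
  obtains e where "idem e" "\<forall>x\<in>I. e \<otimes> x = x"
    "\<forall>y\<in>carrier R. (\<forall>x\<in>I. y \<otimes> x = \<zero>) \<longrightarrow> y \<otimes> e = \<zero>"
    "\<forall>r\<in>carrier R. e \<otimes> r = r \<otimes> e"
proof -
  define A where "A = principal ` I"
  have A: "A \<subseteq> carrier (principal_right_ideals R)"
    using I(1) by (auto simp: A_def principal_closed)
  obtain e where e: "idem e" "\<Squnion>\<^bsub>principal_right_ideals R\<^esub> A = principal e"
    using principal_eq_idem lat.sup_closed[OF A] by blast
  have [simp]: "e \<in> carrier R" "e \<otimes> e = e" using e by auto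
  have mem: "x \<in> principal x" if "x \<in> carrier R" for x
    using that by (auto simp: mem_principal intro!: bexI[of _ \<one>])
  have absorb: "e \<otimes> x = x" if "x \<in> I" for x
  proof -
    have "principal x \<subseteq> principal e"
      using lat.sup_upper[of A "principal x"] A that e by (auto simp: A_def)
    then show ?thesis using mem[of x] I(1) that mem_principal_idem[OF e(1)] by blast
  qed
  have ann: "y \<otimes> e = \<zero>" if y: "y \<in> carrier R" "\<And>x. x \<in> I \<Longrightarrow> y \<otimes> x = \<zero>" for y
  proof -
    \<comment> \<open>The right annihilator \<open>uR\<close> of \<open>y\<close> contains every
      member of \<open>A\<close>, hence also the supremum \<open>eR\<close>.\<close>
    obtain u where u: "idem u" "y \<otimes> u = \<zero>" "\<forall>x\<in>carrier R. y \<otimes> x = \<zero> \<longrightarrow> u \<otimes> x = x"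
      using annihilator[OF y(1)] .
    have "principal x \<subseteq> principal u" if "x \<in> I" for x
      using that I(1) y(2)[OF that] u(1,3) by (intro principal_subset_idem) auto
    then have "\<Squnion>\<^bsub>principal_right_ideals R\<^esub> A \<subseteq> principal u"
      using lat.sup_least[OF A, of "principal u"] u(1) by (auto simp: A_def principal_closed idemD(1))
    then have "u \<otimes> e = e" using e mem[of e] mem_principal_idem[OF u(1)] by auto
    then show ?thesis using u y mult_rewrite[OF u(2), of e] by auto
  qed
  define f where "f = \<one> \<ominus> e"
  have f: "idem f" "f \<otimes> e = \<zero>" "e \<otimes> f = \<zero>" using idem_compl[OF e(1)] by (auto simp: f_def)
  have [simp]: "f \<in> carrier R" using f by auto
  \<comment> \<open>\<open>I\<close> is a left ideal fixed by \<open>e\<close>, so \<open>fr\<close>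
    annihilates \<open>I\<close> and therefore \<open>e\<close>.\<close>
  have fe: "f \<otimes> r \<otimes> e = \<zero>" if "r \<in> carrier R" for r
  proof (rule ann)
    fix x assume x: "x \<in> I"
    then have "f \<otimes> (e \<otimes> (r \<otimes> x)) = \<zero>" using I that by (simp add: mult_rewrite[OF f(2)] subset_iff)
    then show "f \<otimes> r \<otimes> x = \<zero>" using x I that absorb[OF I(2)[OF that x]] by (auto simp: m_assoc)
  qed (use that in simp)
  \<comment> \<open>Semiprimeness: for \<open>a = erf\<close>, the product \<open>aba\<close>
    contains the factor \<open>fbe = 0\<close>.\<close>
  have ef: "e \<otimes> r \<otimes> f = \<zero>" if r: "r \<in> carrier R" for r
  proof -
    define a where "a = e \<otimes> r \<otimes> f"
    have [simp]: "a \<in> carrier R" using r by (simp add: a_def)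
    obtain b where b: "b \<in> carrier R" "a \<otimes> b \<otimes> a = a" using regularE[of a] by auto
    have "a \<otimes> b \<otimes> a = e \<otimes> r \<otimes> (f \<otimes> b \<otimes> e) \<otimes> (r \<otimes> f)"
      using b(1) r by (simp add: a_def m_assoc)
    then show ?thesis using b fe[OF b(1)] r by (simp add: a_def)
  qed
  have "e \<otimes> r = r \<otimes> e" if r: "r \<in> carrier R" for r
  proof -
    have "r \<otimes> e = e \<otimes> r \<otimes> e" using fe[OF r] r by (simp add: f_def expand add_minus_eq_0_iff)
    moreover have "e \<otimes> r = e \<otimes> r \<otimes> e" using ef[OF r] r by (simp add: f_def expand add_minus_eq_0_iff)
    ultimately show ?thesis by simp
  qed
  with that e absorb ann show ?thesis by blast
qed

text \<open>If \<open>bRa = 0\<close>, the left ideal of all \<open>x\<close> with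
  \<open>bRx = 0\<close> yields a central idempotent \<open>e\<close> by
  \<open>ideal_generator\<close>. It is not 0, as it fixes \<open>a\<close>, and not 1, as
  \<open>be = 0\<close>.\<close>

lemma prime:
  assumes "a \<in> carrier R" "b \<in> carrier R" "a \<noteq> \<zero>" "b \<noteq> \<zero>"
  obtains r where "r \<in> carrier R" "b \<otimes> r \<otimes> a \<noteq> \<zero>"
proof (rule ccontr)
  assume "\<not> thesis"
  note [simp] = assms(1,2)
  define I where "I = {x \<in> carrier R. \<forall>r\<in>carrier R. b \<otimes> r \<otimes> x = \<zero>}"
  have "a \<in> I" using that \<open>\<not> thesis\<close> by (auto simp: I_def)
  have I: "I \<subseteq> carrier R" by (auto simp: I_def)
  have "b \<otimes> s \<otimes> (r \<otimes> x) = \<zero>" if "s \<in> carrier R" "r \<in> carrier R" "x \<in> I" for r s x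
    using that m_assoc[of "b \<otimes> s" r x] m_assoc[of b s r] by (auto simp: I_def)
  then have "r \<otimes> x \<in> I" if "r \<in> carrier R" "x \<in> I" for r x
    using that by (auto simp: I_def)
  then obtain e where e: "idem e" "\<forall>x\<in>I. e \<otimes> x = x"
    "\<forall>y\<in>carrier R. (\<forall>x\<in>I. y \<otimes> x = \<zero>) \<longrightarrow> y \<otimes> e = \<zero>"
    "\<forall>r\<in>carrier R. e \<otimes> r = r \<otimes> e"
    using ideal_generator[OF I] by blast
  have "e = \<zero> \<or> e = \<one>" using central_idem e by blast
  moreover have "e \<noteq> \<zero>" using e(2) \<open>a \<in> I\<close> assms by auto
  moreover have "b \<otimes> x = \<zero>" if "x \<in> I" for x
    using that unfolding I_def by (auto dest!: bspec[OF _ one_closed])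
  then have "b \<otimes> e = \<zero>" using e(3) by simp
  ultimately show False using assms by auto
qed

text \<open>The last property is meet continuity in terms of intersections. Although the supremum
  may exceed the union of the chain, trivial intersection with a fixed right ideal thus survives, as
  Zorn's lemma will require.\<close>

lemma chain_sup:
  assumes C: "C \<subseteq> carrier (principal_right_ideals R)" "\<forall>Y\<in>C. \<forall>Z\<in>C. Y \<subseteq> Z \<or> Z \<subseteq> Y"
  obtains U where "U \<in> carrier (principal_right_ideals R)" "\<forall>Y\<in>C. Y \<subseteq> U"
    "\<forall>V\<in>carrier (principal_right_ideals R). (\<forall>Y\<in>C. Y \<subseteq> V) \<longrightarrow> U \<subseteq> V"
    "\<forall>V\<in>carrier (principal_right_ideals R). (\<forall>Y\<in>C. V \<inter> Y \<subseteq> {\<zero>}) \<longrightarrow> V \<inter> U \<subseteq> {\<zero>}"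
proof
  define L where "L = principal_right_ideals R"
  define U where "U = \<Squnion>\<^bsub>L\<^esub> C"
  have zero: "{\<zero>} \<in> carrier L" "principal \<zero> = {\<zero>}"
  proof -
    show "principal \<zero> = {\<zero>}" using carrier_not_empty by (auto simp: l_coset_def)
    then show "{\<zero>} \<in> carrier L" using principal_closed[of \<zero>] by (simp add: L_def)
  qed
  show U: "U \<in> carrier (principal_right_ideals R)"
    using lat.sup_closed[OF C(1)] by (simp add: U_def L_def)
  show "\<forall>Y\<in>C. Y \<subseteq> U"
    using lat.sup_upper[OF C(1)] by (simp add: U_def L_def)
  show "\<forall>V\<in>carrier (principal_right_ideals R). (\<forall>Y\<in>C. Y \<subseteq> V) \<longrightarrow> U \<subseteq> V"
    using lat.sup_least[OF C(1)] by (auto simp: U_def L_def)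
  show "\<forall>V\<in>carrier (principal_right_ideals R). (\<forall>Y\<in>C. V \<inter> Y \<subseteq> {\<zero>}) \<longrightarrow> V \<inter> U \<subseteq> {\<zero>}"
  proof (intro ballI impI subsetI)
    fix V z assume V: "V \<in> carrier (principal_right_ideals R)" "\<forall>Y\<in>C. V \<inter> Y \<subseteq> {\<zero>}"
      and z: "z \<in> V \<inter> U"
    have meet: "V \<sqinter>\<^bsub>L\<^esub> Y \<subseteq> {\<zero>}" if "Y \<in> C" for Y
      using lat.meet_left[of V Y] lat.meet_right[of V Y] V that C(1) by (fastforce simp: L_def)
    have "(\<lambda>Y. V \<sqinter>\<^bsub>L\<^esub> Y) ` C \<subseteq> carrier L"
      using lat.meet_closed V C(1) by (auto simp: L_def)
    then have "\<Squnion>\<^bsub>L\<^esub> ((\<lambda>Y. V \<sqinter>\<^bsub>L\<^esub> Y) ` C) \<subseteq> {\<zero>}"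
      using lat.sup_least[of "(\<lambda>Y. V \<sqinter>\<^bsub>L\<^esub> Y) ` C" "{\<zero>}"] meet zero(1)
      unfolding L_def le_iff by (metis (no_types, lifting) imageE)
    then have small: "V \<sqinter>\<^bsub>L\<^esub> U \<subseteq> {\<zero>}"
      using lat.meet_continuous[OF C(1) _ V(1)] C(2) by (simp add: L_def U_def)
    obtain v u where vu: "idem v" "V = principal v" "idem u" "U = principal u"
      using principal_eq_idem U V(1) by metis
    have zR: "z \<in> carrier R" "v \<otimes> z = z" "u \<otimes> z = z"
      using z vu by (auto simp: mem_principal_idem)
    \<comment> \<open>A common element \<open>z\<close> generates a right ideal below both
      \<open>V\<close> and \<open>U\<close>, hence below their lattice meet, which is already known
      to be trivial.\<close>
    then have "principal z \<subseteq> V" "principal z \<subseteq> U" using principal_subset_idem vu by auto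
    then have "principal z \<subseteq> V \<sqinter>\<^bsub>L\<^esub> U"
      using lat.meet_le[of "principal z" V U] V U principal_closed[of z] zR by (simp add: L_def)
    moreover have "z \<in> principal z"
      using zR by (auto simp: mem_principal intro!: bexI[of _ \<one>])
    ultimately show "z \<in> {\<zero>}" using small by blast
  qed
qed

section \<open>Partial isomorphisms and comparability of idempotents\<close>

lemma left_inverse:
  assumes a: "a \<in> carrier R" "idem e" "a \<otimes> e = a"
    and inj: "\<And>w. \<lbrakk>w \<in> carrier R; a \<otimes> w = \<zero>\<rbrakk> \<Longrightarrow> e \<otimes> w = \<zero>"
  obtains b where "b \<in> carrier R" "b \<otimes> a = e"
proof -
  have [simp]: "e \<in> carrier R" "e \<otimes> e = e" "a \<in> carrier R" using a by auto
  obtain y where y: "y \<in> carrier R" "a \<otimes> y \<otimes> a = a" using regularE[of a] by auto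
  \<comment> \<open>Since \<open>aya = a = ae\<close>, the element \<open>ya - e\<close> lies in the
    kernel of \<open>a\<close>, so injectivity on \<open>eR\<close> gives
    \<open>eya = e\<close>.\<close>
  then have "a \<otimes> (y \<otimes> a \<ominus> e) = \<zero>" by (simp add: expand a)
  then have "e \<otimes> (y \<otimes> a \<ominus> e) = \<zero>" using inj y by simp
  then have "e \<otimes> y \<otimes> a = e"
    using y by (simp add: expand add_minus_eq_0_iff)
  then show ?thesis using that[of "e \<otimes> y"] y by simp
qed

text \<open>Zorn's lemma gives a maximal partial isomorphism with graph \<open>gR\<close>. The last
  conclusion says that its domain \<open>egR\<close> is all of \<open>eR\<close> or its range
  \<open>fgR\<close> is all of \<open>fR\<close>.\<close>

lemma maximal_graph:
  assumes e: "idem e" and f: "idem f" and ef: "e \<otimes> f = \<zero>" "f \<otimes> e = \<zero>"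
  obtains g where "g \<in> carrier R" "e \<otimes> g \<oplus> f \<otimes> g = g"
    "\<forall>w\<in>carrier R. e \<otimes> g \<otimes> w = \<zero> \<longrightarrow> g \<otimes> w = \<zero>"
    "\<forall>w\<in>carrier R. f \<otimes> g \<otimes> w = \<zero> \<longrightarrow> g \<otimes> w = \<zero>"
    "(\<exists>v\<in>carrier R. e \<otimes> g \<otimes> v = e) \<or> (\<exists>v\<in>carrier R. f \<otimes> g \<otimes> v = f)"
proof -
  have [simp]: "e \<in> carrier R" "e \<otimes> e = e" "f \<in> carrier R" "f \<otimes> f = f" using e f by auto
  \<comment> \<open>Submodules of \<open>eR \<oplus> fR\<close> that meet both summands trivially are the graphs of
    isomorphisms between submodules of \<open>eR\<close> and of \<open>fR\<close>.\<close>
  define graphs where "graphs = {G \<in> carrier (principal_right_ideals R).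
    \<forall>z\<in>G. e \<otimes> z \<oplus> f \<otimes> z = z \<and> (e \<otimes> z = \<zero> \<longrightarrow> z = \<zero>) \<and> (f \<otimes> z = \<zero> \<longrightarrow> z = \<zero>)}"
  have "\<exists>U\<in>graphs. \<forall>G\<in>C. G \<subseteq> U" if "subset.chain graphs C" for C
  proof -
    have C: "C \<subseteq> carrier (principal_right_ideals R)" "\<forall>Y\<in>C. \<forall>Z\<in>C. Y \<subseteq> Z \<or> Z \<subseteq> Y" "C \<subseteq> graphs"
      using that by (auto simp: subset_chain_def graphs_def)
    obtain U where U: "U \<in> carrier (principal_right_ideals R)" "\<forall>Y\<in>C. Y \<subseteq> U"
      "\<forall>V\<in>carrier (principal_right_ideals R). (\<forall>Y\<in>C. Y \<subseteq> V) \<longrightarrow> U \<subseteq> V"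
      "\<forall>V\<in>carrier (principal_right_ideals R). (\<forall>Y\<in>C. V \<inter> Y \<subseteq> {\<zero>}) \<longrightarrow> V \<inter> U \<subseteq> {\<zero>}"
      using chain_sup[OF C(1,2)] .
    have carr: "z \<in> carrier R" if "z \<in> G" "G \<in> carrier (principal_right_ideals R)" for z G
      using principal_eq_idem[OF that(2)] that(1) mem_principal_idem by metis
    \<comment> \<open>Elements of \<open>U\<close> need not lie in a member of the chain. The graph
      conditions are therefore rephrased as containment in \<open>(e + f)R\<close> and trivial
      intersection with \<open>(1 - e)R\<close> and \<open>(1 - f)R\<close>, which pass to
      suprema.\<close>
    have ids: "idem (e \<oplus> f)" "idem (\<one> \<ominus> e)" "idem (\<one> \<ominus> f)"
      using idem_compl e f by (auto simp: idem_def expand ef)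
    have Uef: "U \<subseteq> principal (e \<oplus> f)"
    proof -
      have "z \<in> principal (e \<oplus> f)" if "Y \<in> C" "z \<in> Y" for Y z
      proof -
        have "z \<in> carrier R" "e \<otimes> z \<oplus> f \<otimes> z = z"
          using that C carr by (auto simp: graphs_def)
        then show ?thesis by (simp add: mem_principal_idem[OF ids(1)] l_distr)
      qed
      then have "\<forall>Y\<in>C. Y \<subseteq> principal (e \<oplus> f)" by blast
      moreover have "e \<oplus> f \<in> carrier R" by simp
      ultimately show ?thesis using U(3) principal_closed by blast
    qed
    have compl: "z \<in> principal (\<one> \<ominus> c) \<longleftrightarrow> c \<otimes> z = \<zero>"
      if c: "c = e \<or> c = f" and z: "z \<in> carrier R" for c z
    proof -
      have [simp]: "c \<in> carrier R" using c by auto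
      have "(\<one> \<ominus> c) \<otimes> z = z \<longleftrightarrow> c \<otimes> z = \<zero>"
      proof
        assume "(\<one> \<ominus> c) \<otimes> z = z"
        then have "z \<ominus> c \<otimes> z = z" using z by (simp add: expand)
        moreover have "c \<otimes> z = z \<ominus> (z \<ominus> c \<otimes> z)" using z by (simp add: expand)
        ultimately show "c \<otimes> z = \<zero>" using z by simp
      qed (use z in \<open>simp add: expand\<close>)
      moreover have "idem (\<one> \<ominus> c)" using c ids by auto
      ultimately show ?thesis using z by (simp add: mem_principal_idem)
    qed
    have disj: "principal (\<one> \<ominus> c) \<inter> U \<subseteq> {\<zero>}" if c: "c = e \<or> c = f" for c
    proof -
      have "z = \<zero>" if "Y \<in> C" "z \<in> Y" "z \<in> principal (\<one> \<ominus> c)" for Y z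
      proof -
        have "Y \<in> graphs" "z \<in> carrier R" using that(1,2) C carr by auto
        then show ?thesis using that compl[OF c, of z] c by (auto simp: graphs_def)
      qed
      then have "\<forall>Y\<in>C. principal (\<one> \<ominus> c) \<inter> Y \<subseteq> {\<zero>}" by blast
      moreover have "\<one> \<ominus> c \<in> carrier R" using c by auto
      ultimately show ?thesis using U(4) principal_closed by blast
    qed
    have "e \<otimes> z \<oplus> f \<otimes> z = z \<and> (e \<otimes> z = \<zero> \<longrightarrow> z = \<zero>) \<and> (f \<otimes> z = \<zero> \<longrightarrow> z = \<zero>)"
      if z: "z \<in> U" for z
    proof -
      have zR: "z \<in> carrier R" using carr z U(1) by blast
      have "(e \<oplus> f) \<otimes> z = z" using z Uef mem_principal_idem[OF ids(1)] by blast
      moreover have "z = \<zero>" if "c = e \<or> c = f" "c \<otimes> z = \<zero>" for c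
        using disj[OF that(1)] compl[OF that(1) zR] that(2) z by blast
      ultimately show ?thesis using zR by (auto simp: l_distr)
    qed
    then have "U \<in> graphs" using U(1) by (auto simp: graphs_def)
    then show ?thesis using U by blast
  qed
  then obtain M where M: "M \<in> graphs" "\<And>G. \<lbrakk>G \<in> graphs; M \<subseteq> G\<rbrakk> \<Longrightarrow> M = G"
    using subset_Zorn[of graphs] by metis
  obtain g where g: "idem g" "M = principal g"
    using principal_eq_idem M(1) by (auto simp: graphs_def)
  have [simp]: "g \<in> carrier R" using g by auto
  have gM: "g \<otimes> w \<in> M" if "w \<in> carrier R" for w using that g by (auto simp: mem_principal)
  have graph: "e \<otimes> g \<oplus> f \<otimes> g = g"
    "\<And>w. \<lbrakk>w \<in> carrier R; e \<otimes> (g \<otimes> w) = \<zero>\<rbrakk> \<Longrightarrow> g \<otimes> w = \<zero>"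
    "\<And>w. \<lbrakk>w \<in> carrier R; f \<otimes> (g \<otimes> w) = \<zero>\<rbrakk> \<Longrightarrow> g \<otimes> w = \<zero>"
    using M(1) gM gM[of \<one>] by (auto simp: graphs_def)
  have eg: "e \<otimes> g \<in> carrier R" "f \<otimes> g \<in> carrier R" by simp_all
  \<comment> \<open>\<open>k\<close> and \<open>l\<close> generate the domain \<open>egR\<close> and
    the range \<open>fgR\<close> of the maximal partial isomorphism.\<close>
  obtain k v where k: "idem k" "v \<in> carrier R" "k = e \<otimes> g \<otimes> v" "k \<otimes> (e \<otimes> g) = e \<otimes> g"
    using idem_image[OF eg(1)] by blast
  obtain l v' where l: "idem l" "v' \<in> carrier R" "l = f \<otimes> g \<otimes> v'" "l \<otimes> (f \<otimes> g) = f \<otimes> g"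
    using idem_image[OF eg(2)] by blast
  have [simp]: "k \<in> carrier R" "k \<otimes> k = k" "l \<in> carrier R" "l \<otimes> l = l" using k l by auto
  have ek: "e \<otimes> k = k" "f \<otimes> k = \<zero>" using k(2) by (simp_all add: k(3) m_assoc mult_rewrite[of e e e] mult_rewrite[OF ef(2)])
  have fl: "f \<otimes> l = l" "e \<otimes> l = \<zero>" using l(2) by (simp_all add: l(3) m_assoc mult_rewrite[of f f f] mult_rewrite[OF ef(1)])
  have "k \<otimes> e = e \<or> l \<otimes> f = f"
  proof (rule ccontr)
    \<comment> \<open>Primeness connects the complements of the domain and of the range of the maximal partial
      isomorphism, and the graph \<open>(\<alpha> + y)R\<close> of the connecting map can be added to \<open>gR\<close>.\<close>
    assume neither: "\<not> (k \<otimes> e = e \<or> l \<otimes> f = f)"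
    define p where "p = e \<ominus> k \<otimes> e"
    define q where "q = f \<ominus> l \<otimes> f"
    have [simp]: "p \<in> carrier R" "q \<in> carrier R" by (auto simp: p_def q_def)
    have "p \<noteq> \<zero>" "q \<noteq> \<zero>" using neither by (auto simp: p_def q_def)
    then obtain r where r: "r \<in> carrier R" "q \<otimes> r \<otimes> p \<noteq> \<zero>" using prime[of p q] by auto
    define y where "y = q \<otimes> r \<otimes> p"
    have [simp]: "y \<in> carrier R" "r \<in> carrier R" using r by (auto simp: y_def)
    obtain y' where y': "y' \<in> carrier R" "y \<otimes> y' \<otimes> y = y" using regularE[of y] by auto
    note [simp] = y'(1)
    have p: "e \<otimes> p = p" "f \<otimes> p = \<zero>" "k \<otimes> p = \<zero>"
      by (simp_all add: p_def expand mult_rewrite[OF ek(1)] mult_rewrite[OF ek(2)] ef mult_rewrite[of k k k])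
    have q: "f \<otimes> q = q" "e \<otimes> q = \<zero>" "l \<otimes> q = \<zero>"
      by (simp_all add: q_def expand mult_rewrite[OF fl(1)] mult_rewrite[OF fl(2)] ef mult_rewrite[of l l l])
    \<comment> \<open>With this choice \<open>y = qr\<alpha>\<close>, so \<alpha> and
      \<open>y\<close> have the same right annihilator, and \<open>(\<alpha> + y)R\<close> is the
      graph of an isomorphism from \<open>\<alpha>R\<close> onto \<open>yR\<close>.\<close>
    define \<alpha> where "\<alpha> = p \<otimes> y' \<otimes> y"
    have [simp]: "\<alpha> \<in> carrier R" by (simp add: \<alpha>_def)
    have \<alpha>: "e \<otimes> \<alpha> = \<alpha>" "f \<otimes> \<alpha> = \<zero>" "k \<otimes> \<alpha> = \<zero>"
      by (simp_all add: \<alpha>_def m_assoc mult_rewrite[OF p(1)] mult_rewrite[OF p(2)] mult_rewrite[OF p(3)])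
    have y: "f \<otimes> y = y" "e \<otimes> y = \<zero>" "l \<otimes> y = \<zero>"
      by (simp_all add: y_def m_assoc mult_rewrite[OF q(1)] mult_rewrite[OF q(2)] mult_rewrite[OF q(3)])
    have \<alpha>y: "q \<otimes> r \<otimes> \<alpha> = y" using y'(2) by (simp add: \<alpha>_def y_def m_assoc)
    have \<alpha>yR: "\<alpha> \<oplus> y \<in> carrier R" by simp
    obtain w where w: "idem w" "w \<otimes> g = g" "w \<otimes> (\<alpha> \<oplus> y) = \<alpha> \<oplus> y"
      "rk w \<le> rk g + rk (\<alpha> \<oplus> y)" "\<exists>m\<in>carrier R. \<exists>n\<in>carrier R. w = g \<otimes> m \<oplus> (\<alpha> \<oplus> y) \<otimes> n"
      using \<alpha>yR by (rule idem_join[OF g(1)])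
    then obtain m n where mn: "m \<in> carrier R" "n \<in> carrier R" "w = g \<otimes> m \<oplus> (\<alpha> \<oplus> y) \<otimes> n" by auto
    have [simp]: "w \<in> carrier R" using w by auto
    have "principal w \<in> graphs"
      unfolding graphs_def
    proof (intro CollectI conjI ballI impI)
      show "principal w \<in> carrier (principal_right_ideals R)" by (simp add: principal_closed)
      fix z assume "z \<in> principal w"
      then have z: "z \<in> carrier R" "w \<otimes> z = z" using w by (auto simp: mem_principal_idem)
      define s where "s = m \<otimes> z"
      define t where "t = n \<otimes> z"
      have [simp]: "s \<in> carrier R" "t \<in> carrier R" using mn z by (auto simp: s_def t_def)
      have zst: "z = g \<otimes> s \<oplus> (\<alpha> \<otimes> t \<oplus> y \<otimes> t)"
        using z mn by (simp add: s_def t_def l_distr m_assoc)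
      have ez: "e \<otimes> z = e \<otimes> (g \<otimes> s) \<oplus> \<alpha> \<otimes> t"
        by (simp add: zst r_distr mult_rewrite[OF \<alpha>(1)] mult_rewrite[OF y(2)])
      have fz: "f \<otimes> z = f \<otimes> (g \<otimes> s) \<oplus> y \<otimes> t"
        by (simp add: zst r_distr mult_rewrite[OF \<alpha>(2)] mult_rewrite[OF y(1)])
      have "e \<otimes> (g \<otimes> s) \<oplus> f \<otimes> (g \<otimes> s) = g \<otimes> s"
        using arg_cong[OF graph(1), of "\<lambda>x. x \<otimes> s"] by (simp add: l_distr m_assoc)
      moreover have "e \<otimes> z \<oplus> f \<otimes> z = (e \<otimes> (g \<otimes> s) \<oplus> f \<otimes> (g \<otimes> s)) \<oplus> (\<alpha> \<otimes> t \<oplus> y \<otimes> t)"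
        unfolding ez fz by (simp add: a_ac)
      ultimately show "e \<otimes> z \<oplus> f \<otimes> z = z" using zst by simp
      have *: "z = \<zero>" if "g \<otimes> s = \<zero>" "\<alpha> \<otimes> t = \<zero> \<or> y \<otimes> t = \<zero>"
      proof -
        have "y \<otimes> t = q \<otimes> r \<otimes> (\<alpha> \<otimes> t)" by (simp add: \<alpha>y[symmetric] m_assoc)
        moreover have "\<alpha> \<otimes> t = p \<otimes> y' \<otimes> (y \<otimes> t)" by (simp add: \<alpha>_def m_assoc)
        ultimately have "\<alpha> \<otimes> t = \<zero> \<and> y \<otimes> t = \<zero>" using that(2) by auto
        then show ?thesis using that(1) by (simp add: zst)
      qed
      show "z = \<zero>" if "e \<otimes> z = \<zero>"
      proof -
        \<comment> \<open>\<open>k\<close> fixes the old domain and kills \<alpha>, so it separates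
          the two summands of \<open>ez\<close>; below, \<open>l\<close> does the same for
          \<open>fz\<close>.\<close>
        have "k \<otimes> (e \<otimes> (g \<otimes> s)) = e \<otimes> (g \<otimes> s)"
          using mult_rewrite[OF k(4), of s] by (simp add: m_assoc)
        then have "k \<otimes> (e \<otimes> z) = e \<otimes> (g \<otimes> s)"
          by (simp add: ez r_distr mult_rewrite[OF \<alpha>(3)])
        then have "e \<otimes> (g \<otimes> s) = \<zero>" using that by simp
        moreover from this have "g \<otimes> s = \<zero>" by (rule graph(2)[rotated]) simp
        ultimately show ?thesis using * that by (simp add: ez)
      qed
      show "z = \<zero>" if "f \<otimes> z = \<zero>"
      proof -
        have "l \<otimes> (f \<otimes> (g \<otimes> s)) = f \<otimes> (g \<otimes> s)"
          using mult_rewrite[OF l(4), of s] by (simp add: m_assoc)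
        then have "l \<otimes> (f \<otimes> z) = f \<otimes> (g \<otimes> s)"
          by (simp add: fz r_distr mult_rewrite[OF y(3)])
        then have "f \<otimes> (g \<otimes> s) = \<zero>" using that by simp
        moreover from this have "g \<otimes> s = \<zero>" by (rule graph(3)[rotated]) simp
        ultimately show ?thesis using * that by (simp add: fz)
      qed
    qed
    moreover have "M \<subseteq> principal w"
      unfolding g(2) by (rule principal_subset_idem) (use w in auto)
    ultimately have "M = principal w" by (rule M(2))
    moreover have "\<alpha> \<oplus> y \<in> principal w" using w(3) \<alpha>yR mem_principal_idem[OF w(1)] by blast
    ultimately have "\<alpha> \<oplus> y \<in> principal g" using g(2) by blast
    then obtain u where u: "u \<in> carrier R" "\<alpha> \<oplus> y = g \<otimes> u"
      unfolding mem_principal by blast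
    \<comment> \<open>Maximality has put \<alpha> into the old domain, which \<open>k\<close> fixes,
      although \<open>k\<close> kills \<alpha>.\<close>
    have "k \<otimes> (e \<otimes> (g \<otimes> u)) = e \<otimes> (g \<otimes> u)"
      using mult_rewrite[OF k(4), of u] u by (simp add: m_assoc)
    moreover have "e \<otimes> (g \<otimes> u) = \<alpha>" by (simp add: u(2)[symmetric] r_distr \<alpha> y)
    ultimately have "\<alpha> = \<zero>" using \<alpha>(3) by simp
    then show False using \<alpha>y r by (simp add: y_def)
  qed
  then have "(\<exists>v\<in>carrier R. e \<otimes> g \<otimes> v = e) \<or> (\<exists>v\<in>carrier R. f \<otimes> g \<otimes> v = f)"
  proof
    assume "k \<otimes> e = e"
    then have "e \<otimes> g \<otimes> (v \<otimes> e) = e" using k(2) m_assoc[of "e \<otimes> g" v e] by (simp add: k(3)[symmetric])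
    then show ?thesis using m_closed[OF k(2) \<open>e \<in> carrier R\<close>] by blast
  next
    assume "l \<otimes> f = f"
    then have "f \<otimes> g \<otimes> (v' \<otimes> f) = f" using l(2) m_assoc[of "f \<otimes> g" v' f] by (simp add: l(3)[symmetric])
    then show ?thesis using m_closed[OF l(2) \<open>f \<in> carrier R\<close>] by blast
  qed
  moreover have "\<forall>w\<in>carrier R. e \<otimes> g \<otimes> w = \<zero> \<longrightarrow> g \<otimes> w = \<zero>"
    "\<forall>w\<in>carrier R. f \<otimes> g \<otimes> w = \<zero> \<longrightarrow> g \<otimes> w = \<zero>"
    using graph(2,3) m_assoc[of e g] m_assoc[of f g] by force+
  ultimately show ?thesis using graph(1) that[OF \<open>g \<in> carrier R\<close>] by blast
qed

text \<open>If the maximal partial isomorphism exhausts \<open>eR\<close>, it gives the embedding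
  \<open>a\<close> directly. If it exhausts \<open>fR\<close>, its inverse \<open>b\<close> embeds
  \<open>fR\<close> into \<open>eR\<close>, and \<open>rk e \<le> rk f \<le> rk b\<close> forces the
  image of \<open>b\<close> to be all of \<open>eR\<close>, so \<open>b\<close> can be
  inverted.\<close>

lemma comparability:
  assumes e: "idem e" and f: "idem f" and ef: "e \<otimes> f = \<zero>" "f \<otimes> e = \<zero>" and rk: "rk e \<le> rk f"
  obtains a b where "a \<in> carrier R" "b \<in> carrier R" "f \<otimes> a = a" "a \<otimes> e = a" "b \<otimes> a = e"
proof -
  have [simp]: "e \<in> carrier R" "e \<otimes> e = e" "f \<in> carrier R" "f \<otimes> f = f" using e f by auto
  obtain g where g: "g \<in> carrier R" "e \<otimes> g \<oplus> f \<otimes> g = g"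
    "\<forall>w\<in>carrier R. e \<otimes> g \<otimes> w = \<zero> \<longrightarrow> g \<otimes> w = \<zero>"
    "\<forall>w\<in>carrier R. f \<otimes> g \<otimes> w = \<zero> \<longrightarrow> g \<otimes> w = \<zero>"
    "(\<exists>v\<in>carrier R. e \<otimes> g \<otimes> v = e) \<or> (\<exists>v\<in>carrier R. f \<otimes> g \<otimes> v = f)"
    using maximal_graph[OF e f ef] by blast
  note [simp] = g(1)
  show ?thesis using g(5)
  proof (elim disjE bexE)
    fix v assume v: "v \<in> carrier R" "e \<otimes> g \<otimes> v = e"
    note [simp] = v(1)
    define a where "a = f \<otimes> g \<otimes> v \<otimes> e"
    have a: "a \<in> carrier R" "f \<otimes> a = a" "a \<otimes> e = a"
      by (simp_all add: a_def m_assoc mult_rewrite[of f f f])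
    have inj: "e \<otimes> w = \<zero>" if w: "w \<in> carrier R" "a \<otimes> w = \<zero>" for w
    proof -
      have "f \<otimes> g \<otimes> (v \<otimes> (e \<otimes> w)) = \<zero>" using w by (simp add: a_def m_assoc)
      then have "g \<otimes> (v \<otimes> (e \<otimes> w)) = \<zero>" using g(4) w by simp
      then have "e \<otimes> g \<otimes> v \<otimes> (e \<otimes> w) = \<zero>" using w by (simp add: m_assoc)
      then show ?thesis using w v(2) by (simp add: mult_rewrite[of e e e])
    qed
    obtain b where "b \<in> carrier R" "b \<otimes> a = e" by (rule left_inverse[OF a(1) e a(3) inj])
    then show ?thesis using that a by blast
  next
    fix v assume v: "v \<in> carrier R" "f \<otimes> g \<otimes> v = f"
    note [simp] = v(1)
    define b where "b = e \<otimes> g \<otimes> v \<otimes> f"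
    have b: "b \<in> carrier R" "e \<otimes> b = b" "b \<otimes> f = b"
      by (simp_all add: b_def m_assoc mult_rewrite[of e e e])
    have inj: "f \<otimes> w = \<zero>" if w: "w \<in> carrier R" "b \<otimes> w = \<zero>" for w
    proof -
      have "e \<otimes> g \<otimes> (v \<otimes> (f \<otimes> w)) = \<zero>" using w by (simp add: b_def m_assoc)
      then have "g \<otimes> (v \<otimes> (f \<otimes> w)) = \<zero>" using g(3) w by simp
      then have "f \<otimes> g \<otimes> v \<otimes> (f \<otimes> w) = \<zero>" using w by (simp add: m_assoc)
      then show ?thesis using w v(2) by (simp add: mult_rewrite[of f f f])
    qed
    obtain c where c: "c \<in> carrier R" "c \<otimes> b = f" by (rule left_inverse[OF b(1) f b(3) inj])
    then have "rk e \<le> rk b" using rk rk_mult_right[of c b] b by simp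
    then obtain w where w: "w \<in> carrier R" "b \<otimes> w = e" using rk_eq_imp_absorb[OF e b(1,2)] by blast
    have "b \<otimes> (f \<otimes> w \<otimes> e) = e" using w b by (simp add: m_assoc[symmetric])
    moreover have "f \<otimes> (f \<otimes> w \<otimes> e) = f \<otimes> w \<otimes> e" "f \<otimes> w \<otimes> e \<otimes> e = f \<otimes> w \<otimes> e"
      using w by (simp_all add: m_assoc mult_rewrite[of f f f])
    ultimately show ?thesis using that[of "f \<otimes> w \<otimes> e" b] w b by simp
  qed
qed

text \<open>\<open>comparability\<close> requires orthogonal idempotents, but \<open>a\<close> and
  \<open>r\<close> are unrelated. The kernel of \<open>a\<close> in \<open>rR\<close> still has rank
  at least \<open>rk r - rk a \<ge> rk a\<close>, which is where the factor 2 enters, and receives a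
  copy of \<open>a\<close>.\<close>

lemma subidem_of_rank:
  assumes a: "idem a" and r: "idem r" and rk: "2 * rk a \<le> rk r"
  obtains d where "idem d" "r \<otimes> d = d" "d \<otimes> r = d" "rk d = rk a"
proof -
  have [simp]: "a \<in> carrier R" "a \<otimes> a = a" "r \<in> carrier R" "r \<otimes> r = r" using a r by auto
  \<comment> \<open>\<open>c\<close> generates the kernel of \<open>a\<close> in \<open>rR\<close>, which is disjoint from \<open>aR\<close>.\<close>
  obtain y where y: "y \<in> carrier R" "a \<otimes> r \<otimes> y \<otimes> (a \<otimes> r) = a \<otimes> r" using regularE[of "a \<otimes> r"] by auto
  note [simp] = y(1)
  define k where "k = r \<otimes> y \<otimes> a \<otimes> r"
  have [simp]: "k \<in> carrier R" by (simp add: k_def)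
  have ak: "a \<otimes> k = a \<otimes> r" using y by (simp add: k_def m_assoc)
  have rk': "r \<otimes> k = k" "k \<otimes> r = k" by (simp_all add: k_def m_assoc mult_rewrite[of r r r])
  have "k \<otimes> k = r \<otimes> y \<otimes> (a \<otimes> k)" by (simp add: k_def m_assoc mult_rewrite[of r r r])
  then have kk: "k \<otimes> k = k" by (simp add: ak) (simp add: k_def m_assoc)
  define c where "c = r \<ominus> k"
  have c: "idem c" "r \<otimes> c = c" "c \<otimes> r = c" "a \<otimes> c = \<zero>" "k \<otimes> c = \<zero>" "c \<otimes> k = \<zero>"
    by (simp_all add: c_def idem_def expand kk rk' ak)
  have [simp]: "c \<in> carrier R" "c \<otimes> c = c" using c by auto
  have "k \<oplus> c = r" by (simp add: c_def expand)
  then have "rk r = rk k + rk c"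
    using rk_orthogonal[of k c] kk c by (simp add: idem_def)
  moreover have "rk k \<le> rk a"
    using rk_mult_right[of "r \<otimes> y" "a \<otimes> r"] rk_mult_left[of a r] by (simp add: k_def m_assoc)
  ultimately have rc: "rk a \<le> rk c" using rk by simp
  \<comment> \<open>\<open>a'\<close> is \<open>(1 - c)a\<close>: orthogonal to \<open>c\<close>,
    and of the same rank as \<open>a\<close> since \<open>aa' = a\<close> and
    \<open>a'a = a'\<close>.\<close>
  define a' where "a' = a \<ominus> c \<otimes> a"
  have [simp]: "a' \<in> carrier R" by (simp add: a'_def)
  have a': "idem a'" "a' \<otimes> c = \<zero>" "c \<otimes> a' = \<zero>" "a \<otimes> a' = a" "a' \<otimes> a = a'"
    using c(4) by (simp_all add: a'_def idem_def expand mult_rewrite[OF c(4)] mult_rewrite[of c c c])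
  have ra: "rk a' = rk a"
    using rk_mult_right[of a a'] rk_mult_right[of a' a] a'(4,5) by simp
  obtain x b where x: "x \<in> carrier R" "b \<in> carrier R" "c \<otimes> x = x" "x \<otimes> a' = x" "b \<otimes> x = a'"
    using comparability[OF a'(1) c(1) a'(2,3)] rc ra by metis
  note [simp] = x(1,2)
  have a'a' [simp]: "a' \<otimes> a' = a'" using a' by auto
  \<comment> \<open>As \<open>bcx = a'\<close> and \<open>xa' = x\<close>, this is an idempotent
    with image \<open>xR\<close>, the copy of \<open>a'R\<close> inside \<open>cR\<close>.\<close>
  define d where "d = x \<otimes> b \<otimes> c"
  have bcx: "b \<otimes> (c \<otimes> x) = a'" by (simp add: x)
  have [simp]: "d \<in> carrier R" by (simp add: d_def)
  have dx: "d \<otimes> x = x" by (simp add: d_def m_assoc bcx x)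
  have "idem d" by (simp add: idem_def) (simp add: d_def m_assoc mult_rewrite[OF bcx[unfolded m_assoc[symmetric]]] mult_rewrite[OF dx[unfolded d_def]] mult_rewrite[OF x(3)] mult_rewrite[OF x(4)] mult_rewrite[OF x(5)])
  moreover have "r \<otimes> x = x" using mult_rewrite[OF c(2), of x] x by simp
  then have "r \<otimes> d = d" by (simp add: d_def m_assoc mult_rewrite[of r x x])
  moreover have "d \<otimes> r = d" by (simp add: d_def m_assoc c)
  moreover have "rk d = rk a"
  proof -
    have "rk d \<le> rk x" using rk_mult_left[of x "b \<otimes> c"] by (simp add: d_def m_assoc)
    moreover have "rk x \<le> rk d" using rk_mult_left[of d x] dx by simp
    moreover have "rk x \<le> rk a'" using rk_mult_right[of x a'] x by simp
    moreover have "rk a' \<le> rk x" using rk_mult_right[of b x] x by simp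
    ultimately show ?thesis using ra by simp
  qed
  ultimately show ?thesis by (rule that)
qed

text \<open>If all nonzero elements had rank at least \<epsilon>, every ball of radius \<epsilon>
  would be a singleton.\<close>

lemma small_idem:
  assumes nondiscrete: "\<not> rank_discrete R rk" and \<epsilon>: "0 < \<epsilon>"
  obtains a where "idem a" "0 < rk a" "rk a < \<epsilon>"
proof -
  have "\<exists>a\<in>carrier R. a \<noteq> \<zero> \<and> rk a < \<epsilon>"
  proof (rule ccontr)
    assume *: "\<not> ?thesis"
    have "openin rank.mtopology {x}" if x: "x \<in> carrier R" for x
    proof -
      have "z = x" if "z \<in> carrier R" "rk (x \<ominus> z) < \<epsilon>" for z
        using * x that minus_closed[of x z] r_right_minus_eq[of x z] by blast
      then have "rank.mball x \<epsilon> \<subseteq> {x}"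
        using x by (auto simp: rank.mball_def rank_dist_def)
      then show ?thesis using x \<epsilon> by (auto simp: rank.openin_mtopology)
    qed
    then have "rank.mtopology = discrete_topology (carrier R)"
      by (metis discrete_topology_unique rank.topspace_mtopology)
    then show False using nondiscrete by (simp add: rank_discrete_def rank_topology_def)
  qed
  then obtain a where a: "a \<in> carrier R" "a \<noteq> \<zero>" "rk a < \<epsilon>" by blast
  then show ?thesis using idem_image[OF a(1)] rk_pos that by metis
qed

end

section \<open>Groups containing the splitting involutions are dense\<close>

text \<open>In the application, \<open>N\<close> consists of the units that fix the support of the
  measure pointwise.\<close>

locale split_involution_group = irreducible_continuous_rank_ring +
  fixes N :: "'a set"
  assumes one_mem: "\<one> \<in> N"
    and mult_mem: "\<lbrakk>u \<in> N; v \<in> N\<rbrakk> \<Longrightarrow> u \<otimes> v \<in> N"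
    and involution_mem: "\<lbrakk>idem e; y \<in> carrier R; e \<otimes> y \<otimes> e = e \<oplus> e\<rbrakk> \<Longrightarrow> \<one> \<ominus> y \<otimes> e \<in> N"
    and subset_Units: "N \<subseteq> Units R"
begin

lemma unipotent_mem:
  assumes x: "x \<in> carrier R" "x \<otimes> x = \<zero>"
  shows "\<one> \<oplus> x \<in> N"
proof -
  note [simp] = x
  \<comment> \<open>\<open>1 + x = (1 - 2f - x)(1 - 2f)\<close> for an idempotent \<open>f\<close> with \<open>xf = x\<close> and \<open>fx = 0\<close>\<close>
  obtain b where b: "b \<in> carrier R" "x \<otimes> b \<otimes> x = x" using regularE x(1) .
  note [simp] = b(1)
  have xbx: "x \<otimes> (b \<otimes> x) = x" using b by (simp add: m_assoc)
  define f where "f = b \<otimes> x"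
  have [simp]: "f \<in> carrier R" by (simp add: f_def)
  have f: "f \<otimes> f = f" "f \<otimes> x = \<zero>" "x \<otimes> f = x"
    by (simp_all add: f_def m_assoc xbx)
  then have "idem f" by (simp add: idem_def)
  have "\<one> \<ominus> (\<one> \<oplus> \<one>) \<otimes> f \<in> N"
    using \<open>idem f\<close> by (intro involution_mem) (simp_all add: expand f)
  \<comment> \<open>Here \<open>f(2f + x)f = 2f\<close> because \<open>fx = 0\<close>, and
    \<open>(2f + x)f = 2f + x\<close> because \<open>xf = x\<close>.\<close>
  moreover have "\<one> \<ominus> (f \<oplus> f \<oplus> x) \<otimes> f \<in> N"
    using \<open>idem f\<close> by (intro involution_mem) (simp_all add: l_distr r_distr f)
  ultimately have "(\<one> \<ominus> (f \<oplus> f \<oplus> x) \<otimes> f) \<otimes> (\<one> \<ominus> (\<one> \<oplus> \<one>) \<otimes> f) \<in> N"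
    by (simp add: mult_mem)
  moreover have "(\<one> \<ominus> (f \<oplus> f \<oplus> x) \<otimes> f) \<otimes> (\<one> \<ominus> (\<one> \<oplus> \<one>) \<otimes> f) = \<one> \<oplus> x"
  proof -
    define g where "g = f \<oplus> f"
    define s where "s = \<one> \<ominus> g"
    have [simp]: "g \<in> carrier R" "s \<in> carrier R" by (simp_all add: g_def s_def)
    have gg: "g \<otimes> g = g \<oplus> g" "x \<otimes> g = x \<oplus> x" by (simp_all add: g_def l_distr r_distr f)
    have "g \<otimes> s = \<ominus> g" "x \<otimes> s = \<ominus> x"
      by (simp_all add: s_def minus_eq r_distr r_minus gg minus_add r_neg1 r_neg2)
    moreover have "s \<otimes> s = s \<ominus> g \<otimes> s" by (simp add: s_def minus_eq l_distr l_minus)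
    ultimately have "s \<otimes> s = \<one>" "(s \<ominus> x) \<otimes> s = s \<otimes> s \<oplus> x"
      by (simp_all add: minus_eq l_distr l_minus) (simp add: s_def minus_eq a_assoc l_neg)
    moreover have "\<one> \<ominus> (f \<oplus> f \<oplus> x) \<otimes> f = s \<ominus> x" "\<one> \<ominus> (\<one> \<oplus> \<one>) \<otimes> f = s"
      by (simp_all add: s_def g_def l_distr f expand)
    ultimately show ?thesis by simp
  qed
  ultimately show ?thesis by simp
qed

text \<open>\<xi> and \<eta> act as coordinates dual to \<open>x\<close> and \<open>z\<close> that
  vanish on \<open>A\<close>. The unipotent \<open>1 + z\<xi>\<close> sends \<open>x\<close> to
  \<open>x + z\<close>, and \<open>1 - x\<eta>\<close> sends this to \<open>z\<close>.\<close>

lemma transport_mem: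
  assumes [simp]: "x \<in> carrier R" "z \<in> carrier R" "\<xi> \<in> carrier R" "\<eta> \<in> carrier R" "p \<in> carrier R" "A \<in> carrier R"
    and xz: "x \<otimes> p = x" "z \<otimes> p = z"
    and \<xi>: "\<xi> \<otimes> A = \<zero>" "\<xi> \<otimes> x = p" "\<xi> \<otimes> z = \<zero>"
    and \<eta>: "\<eta> \<otimes> A = \<zero>" "\<eta> \<otimes> x = \<zero>" "\<eta> \<otimes> z = p"
  obtains v where "v \<in> N" "v \<otimes> A = A" "v \<otimes> x = z"
proof -
  define v1 where "v1 = \<one> \<oplus> z \<otimes> \<xi>"
  define v2 where "v2 = \<one> \<oplus> \<ominus> (x \<otimes> \<eta>)"
  have [simp]: "v1 \<in> carrier R" "v2 \<in> carrier R" by (simp_all add: v1_def v2_def)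
  have "v1 \<in> N" unfolding v1_def
    by (rule unipotent_mem) (simp_all add: m_assoc mult_rewrite[OF \<xi>(3)])
  moreover have "v2 \<in> N" unfolding v2_def
    by (rule unipotent_mem) (simp_all add: m_assoc l_minus r_minus mult_rewrite[OF \<eta>(2)])
  ultimately have "v2 \<otimes> v1 \<in> N" by (simp add: mult_mem)
  moreover have "v1 \<otimes> A = A" "v2 \<otimes> A = A" by (simp_all add: v1_def v2_def expand \<xi> \<eta>)
  then have "v2 \<otimes> v1 \<otimes> A = A" by (simp add: m_assoc)
  moreover have "v1 \<otimes> x = x \<oplus> z" by (simp add: v1_def l_distr m_assoc \<xi> xz)
  then have "v2 \<otimes> v1 \<otimes> x = z"
    by (simp add: m_assoc v2_def l_distr r_distr l_minus \<eta> xz) (simp add: expand)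
  ultimately show ?thesis by (rule that)
qed

text \<open>
  To move \<open>hp\<close> back to \<open>p\<close>, go through an isomorphic copy \<open>zR\<close> of \<open>pR\<close> that is independent of
  \<open>AR + pR + hpR\<close>; such a copy exists by comparability as long as \<open>1 - A\<close> is not too small.
\<close>
lemma elimination_step:
  assumes A: "idem A" and h: "h \<in> Units R" "h \<otimes> A = A"
    and a: "idem a" "4 * rk a \<le> rk (\<one> \<ominus> A)"
  obtains p v where "idem p" "A \<otimes> p = \<zero>" "p \<otimes> A = \<zero>" "rk p = rk a"
    "v \<in> N" "v \<otimes> h \<otimes> A = A" "v \<otimes> h \<otimes> p = p"
proof -
  define h' where "h' = inv h"
  have [simp]: "A \<in> carrier R" "A \<otimes> A = A" "h \<in> carrier R" "h' \<in> carrier R" "h' \<otimes> h = \<one>" "h \<otimes> h' = \<one>"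
    using A h by (auto simp: h'_def)
  have h'A: "h' \<otimes> A = A" using mult_rewrite[of h' h \<one> A] h by simp
  define c where "c = \<one> \<ominus> A"
  have c: "idem c" "c \<otimes> A = \<zero>" "A \<otimes> c = \<zero>" using idem_compl[OF A] by (auto simp: c_def)
  have [simp]: "c \<in> carrier R" using c by auto
  have ra: "0 \<le> rk a" using a rk_nonneg by auto
  obtain p where p: "idem p" "c \<otimes> p = p" "p \<otimes> c = p" "rk p = rk a"
    using subidem_of_rank[OF a(1) c(1)] a(2) ra by (auto simp: c_def)
  have [simp]: "p \<in> carrier R" "p \<otimes> p = p" using p by auto
  have Ap: "A \<otimes> p = \<zero>" "p \<otimes> A = \<zero>"
    using mult_rewrite[OF c(3), of p] m_assoc[of p c A] p c by auto
  define x where "x = h \<otimes> p"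
  have [simp]: "x \<in> carrier R" by (simp add: x_def)
  \<comment> \<open>\<open>wR\<close> will contain \<open>AR\<close>, \<open>pR\<close> and
    \<open>xR\<close>, so that \<open>tR\<close> for the complement \<open>t\<close> is independent
    of all three.\<close>
  obtain w1 where w1: "idem w1" "w1 \<otimes> A = A" "w1 \<otimes> p = p" "rk w1 \<le> rk A + rk p"
    using idem_join[OF A \<open>p \<in> carrier R\<close>] by blast
  obtain w where w: "idem w" "w \<otimes> w1 = w1" "w \<otimes> x = x" "rk w \<le> rk w1 + rk x"
    using idem_join[OF w1(1) \<open>x \<in> carrier R\<close>] by blast
  have [simp]: "w \<in> carrier R" "w \<otimes> w = w" "w1 \<in> carrier R" using w w1 by auto
  have wAp: "w \<otimes> A = A" "w \<otimes> p = p"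
    using mult_rewrite[OF w(2), of A] mult_rewrite[OF w(2), of p] w1 by auto
  define t where "t = \<one> \<ominus> w"
  have t: "idem t" "t \<otimes> w = \<zero>" "w \<otimes> t = \<zero>" using idem_compl[OF w(1)] by (auto simp: t_def)
  have [simp]: "t \<in> carrier R" using t by auto
  have tz: "t \<otimes> A = \<zero>" "t \<otimes> x = \<zero>" "t \<otimes> p = \<zero>"
    using mult_rewrite[OF t(2), of A] mult_rewrite[OF t(2), of x] mult_rewrite[OF t(2), of p] wAp w by auto
  have "rk x \<le> rk p" using rk_mult_right[of h p] by (simp add: x_def)
  \<comment> \<open>\<open>w\<close> has rank at most \<open>rk A + 2 rk a\<close>, so
    \<open>t\<close> has rank at least \<open>2 rk a\<close>.\<close>
  then have rt: "rk p \<le> rk t"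
    using w(4) w1(4) p(4) a(2) rk_compl[OF w(1)] rk_compl[OF A] ra by (simp add: t_def)
  \<comment> \<open>\<open>p'\<close> generates the same right ideal as \<open>p\<close>, but is orthogonal to \<open>t\<close>.\<close>
  define p' where "p' = p \<otimes> w"
  have [simp]: "p' \<in> carrier R" by (simp add: p'_def)
  have p': "idem p'" "p' \<otimes> t = \<zero>" "t \<otimes> p' = \<zero>" "p' \<otimes> p = p" "p \<otimes> p' = p'"
    by (simp_all add: p'_def idem_def m_assoc mult_rewrite[OF wAp(2)] mult_rewrite[of p p p] t wAp mult_rewrite[OF tz(3)])
  have "rk p' \<le> rk t" using rk_mult_left[of p w] rt by (simp add: p'_def)
  then obtain z0 b where z0: "z0 \<in> carrier R" "b \<in> carrier R" "t \<otimes> z0 = z0" "z0 \<otimes> p' = z0" "b \<otimes> z0 = p'"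
    using comparability[OF p'(1) t(1) p'(2,3)] by metis
  note [simp] = z0(1,2)
  define z where "z = z0 \<otimes> p"
  \<comment> \<open>Dual coordinates for \<open>transport_mem\<close>: \<eta> for \<open>z\<close>,
    \<xi> for \<open>x\<close> by undoing \<open>h\<close>, and \<open>p'\<close> for
    \<open>p\<close>.\<close>
  define \<eta> where "\<eta> = p \<otimes> b \<otimes> t"
  define \<xi> where "\<xi> = p \<otimes> h' \<otimes> w"
  have [simp]: "z \<in> carrier R" "\<eta> \<in> carrier R" "\<xi> \<in> carrier R" by (simp_all add: z_def \<eta>_def \<xi>_def)
  have zp: "z \<otimes> p = z" by (simp add: z_def m_assoc)
  have xp: "x \<otimes> p = x" by (simp add: x_def m_assoc)
  have tzz: "t \<otimes> z = z" by (simp add: z_def mult_rewrite[OF z0(3)])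
  have wz: "w \<otimes> z = \<zero>" using mult_rewrite[OF t(3), of z] tzz by simp
  have bz: "b \<otimes> z = p" by (simp add: z_def mult_rewrite[OF z0(5)] p')
  have \<eta>: "\<eta> \<otimes> A = \<zero>" "\<eta> \<otimes> x = \<zero>" "\<eta> \<otimes> p = \<zero>" "\<eta> \<otimes> z = p"
    by (simp_all add: \<eta>_def m_assoc tz tzz bz)
  have \<xi>: "\<xi> \<otimes> A = \<zero>" "\<xi> \<otimes> z = \<zero>" "\<xi> \<otimes> x = p"
    by (simp_all add: \<xi>_def m_assoc wAp wz w h'A Ap)
       (simp add: x_def mult_rewrite[of h' h \<one>])
  have \<zeta>: "p' \<otimes> A = \<zero>" "p' \<otimes> z = \<zero>" "p' \<otimes> p = p"
    by (simp_all add: p'_def m_assoc wAp wz Ap)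
  obtain v1 where v1: "v1 \<in> N" "v1 \<otimes> A = A" "v1 \<otimes> x = z"
    by (rule transport_mem[of x z \<xi> \<eta> p A]) (simp_all add: xp zp \<xi> \<eta>)
  obtain v2 where v2: "v2 \<in> N" "v2 \<otimes> A = A" "v2 \<otimes> z = p"
    by (rule transport_mem[of z p \<eta> p' p A]) (simp_all add: zp \<eta> \<zeta>)
  have [simp]: "v1 \<in> carrier R" "v2 \<in> carrier R" using v1 v2 subset_Units by auto
  have "v2 \<otimes> v1 \<otimes> h \<otimes> A = A" by (simp add: m_assoc h v1 v2)
  moreover have "v2 \<otimes> v1 \<otimes> h \<otimes> p = p"
    by (simp add: m_assoc v1 v2 flip: x_def)
  ultimately show ?thesis using that p Ap v1 v2 mult_mem by blast
qed

text \<open>Each elimination step enlarges \<open>A\<close> by an idempotent of rank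
  \<open>rk a\<close>, until less than \<open>4 rk a\<close> is left. As \<open>uh\<close> then
  agrees with 1 on \<open>A\<close>, the rank of \<open>uh - 1\<close> is at most that of
  \<open>1 - A\<close>.\<close>

lemma approximation:
  assumes nondiscrete: "\<not> rank_discrete R rk" and h: "h \<in> Units R" and \<epsilon>: "0 < \<epsilon>"
  obtains u where "u \<in> N" "rk (u \<otimes> h \<ominus> \<one>) < \<epsilon>"
proof -
  have [simp]: "h \<in> carrier R" using h by auto
  obtain a where a: "idem a" "0 < rk a" "rk a < \<epsilon> / 4"
    using small_idem[OF nondiscrete, of "\<epsilon> / 4"] \<epsilon> by auto
  have eliminate: "\<exists>A u. idem A \<and> u \<in> N \<and> u \<otimes> h \<otimes> A = A \<and> rk (\<one> \<ominus> A) < 4 * rk a"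
    if "idem A" "u \<in> N" "u \<otimes> h \<otimes> A = A" "rk (\<one> \<ominus> A) \<le> real n * rk a" for A u n
    using that
  proof (induction n arbitrary: A u)
    case 0
    then show ?case using a by (intro exI[of _ A] exI[of _ u]) auto
  next
    case (Suc n)
    show ?case
    proof (cases "rk (\<one> \<ominus> A) < 4 * rk a")
      case True
      then show ?thesis using Suc.prems by blast
    next
      case False
      have u: "u \<in> Units R" using Suc.prems subset_Units by auto
      then have [simp]: "u \<in> carrier R" by auto
      have [simp]: "A \<in> carrier R" "A \<otimes> A = A" using Suc.prems by auto
      obtain p v where p: "idem p" "A \<otimes> p = \<zero>" "p \<otimes> A = \<zero>" "rk p = rk a"
        "v \<in> N" "v \<otimes> (u \<otimes> h) \<otimes> A = A" "v \<otimes> (u \<otimes> h) \<otimes> p = p"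
        by (rule elimination_step[OF Suc.prems(1) Units_m_closed[OF u h] Suc.prems(3) a(1)]) (use False in simp)
      have [simp]: "p \<in> carrier R" "p \<otimes> p = p" "v \<in> carrier R" using p subset_Units by auto
      have Ap: "idem (A \<oplus> p)" by (simp add: idem_def l_distr r_distr p)
      have "rk (\<one> \<ominus> (A \<oplus> p)) = rk (\<one> \<ominus> A) - rk a"
        using rk_compl[OF Ap] rk_compl[OF Suc.prems(1)] rk_orthogonal[OF Suc.prems(1) p(1-3)] p(4) by simp
      then have "rk (\<one> \<ominus> (A \<oplus> p)) \<le> real n * rk a"
        using Suc.prems(4) by (simp add: algebra_simps)
      moreover have "v \<otimes> u \<otimes> h \<otimes> (A \<oplus> p) = A \<oplus> p"
        using p(6,7) r_distr[of A p "v \<otimes> u \<otimes> h"] m_assoc[of v u h] by simp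
      ultimately show ?thesis using Suc.IH[OF Ap mult_mem[OF p(5) Suc.prems(2)]] by blast
    qed
  qed
  obtain n where "1 / rk a \<le> real n" using real_arch_simple by blast
  then have "rk (\<one> \<ominus> \<zero>) \<le> real n * rk a" using a(2) by (simp add: minus_eq rk_one field_simps)
  moreover have "idem \<zero>" by (simp add: idem_def)
  ultimately obtain A u where A: "idem A" "u \<in> N" "u \<otimes> h \<otimes> A = A" "rk (\<one> \<ominus> A) < 4 * rk a"
    using eliminate[OF _ one_mem, of \<zero> n] by auto
  have [simp]: "A \<in> carrier R" "u \<in> carrier R" using A subset_Units by auto
  have "u \<otimes> h \<ominus> \<one> = (u \<otimes> h \<ominus> \<one>) \<otimes> (\<one> \<ominus> A)"
    using A(3) by (simp add: expand)
  then have "rk (u \<otimes> h \<ominus> \<one>) \<le> rk (\<one> \<ominus> A)"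
    using rk_mult_right[of "u \<otimes> h \<ominus> \<one>" "\<one> \<ominus> A"] by simp
  then show ?thesis using that A a(3) by simp
qed

end

section \<open>Energy of measure preserving involutions\<close>

lemma compact_separation:
  fixes x y :: "'x::t2_space"
  assumes "compact (UNIV :: 'x set)" "x \<noteq> y"
  obtains f :: "'x \<Rightarrow> real" where "continuous_on UNIV f" "\<And>z. 0 \<le> f z" "\<And>z. f z \<le> 1" "f x \<noteq> f y"
proof -
  have "Hausdorff_space (euclidean :: 'x topology)"
    unfolding Hausdorff_space_def disjnt_def using hausdorff by (metis open_openin)
  moreover have "compact_space (euclidean :: 'x topology)"
    using assms(1) by (simp add: compact_space_def compactin_euclidean_iff)
  ultimately have "normal_space (euclidean :: 'x topology)"
    by (simp add: compact_Hausdorff_or_regular_imp_normal_space)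
  then obtain f :: "'x \<Rightarrow> real" where f: "continuous_map euclidean (top_of_set {0..1}) f" "f ` {x} \<subseteq> {0}" "f ` {y} \<subseteq> {1}"
    using Urysohn_lemma[of "euclidean :: 'x topology" "{x}" "{y}" 0 1] assms(2) by auto
  then have "continuous_on UNIV f" "f ` UNIV \<subseteq> {0..1}"
    by (auto simp: continuous_map_in_subtopology)
  moreover from this have "0 \<le> f z" "f z \<le> 1" for z by (auto simp: image_subset_iff)
  ultimately show ?thesis using f by (intro that[of f]) auto
qed

text \<open>
  Twice the difference of the two sides is the square norm of the mixed second difference of \<open>F\<close>
  along \<open>S\<close> and \<open>T\<close>.
\<close>
lemma commuting_involutions_energy:
  fixes F :: "'x \<Rightarrow> real"
  assumes "finite_measure M"
    and S: "S \<in> measurable M M" "distr M M S = M"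
    and T: "T \<in> measurable M M" "distr M M T = M"
    and comm: "\<And>x. S (T x) = T (S x)" and inv: "\<And>x. S (S x) = x"
    and F: "F \<in> borel_measurable M" "\<And>x. \<bar>F x\<bar> \<le> B"
  shows "(\<integral>x. (F (S (T x)) - F x)\<^sup>2 \<partial>M) \<le> (\<integral>x. (F (S x) - F x)\<^sup>2 \<partial>M) + (\<integral>x. (F (T x) - F x)\<^sup>2 \<partial>M)"
proof -
  interpret finite_measure M by fact
  note [measurable] = S(1) T(1) F(1)
  have int: "integrable M (\<lambda>x. (F (\<sigma> x) - F (\<tau> x))\<^sup>2)"
    if [measurable]: "\<sigma> \<in> measurable M M" "\<tau> \<in> measurable M M" for \<sigma> \<tau>
  proof (rule integrable_const_bound[where B = "(2 * B)\<^sup>2"])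
    have "\<bar>F (\<sigma> x) - F (\<tau> x)\<bar> \<le> 2 * B" for x using F(2)[of "\<sigma> x"] F(2)[of "\<tau> x"] by linarith
    then have "(F (\<sigma> x) - F (\<tau> x))\<^sup>2 \<le> (2 * B)\<^sup>2" for x by (metis abs_ge_zero power2_abs power_mono)
    then show "AE x in M. norm ((F (\<sigma> x) - F (\<tau> x))\<^sup>2) \<le> (2 * B)\<^sup>2" by simp
  qed measurable
  have shift: "(\<integral>x. G (\<tau> x) \<partial>M) = (\<integral>x. G x \<partial>M)"
    if "\<tau> \<in> measurable M M" "distr M M \<tau> = M" "G \<in> borel_measurable M" for \<tau> and G :: "'x \<Rightarrow> real"
    using integral_distr[of \<tau> M M G] that by simp
  have ids: "(\<lambda>x. x) \<in> measurable M M" "(\<lambda>x. S (T x)) \<in> measurable M M" by measurable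
  define d where "d \<sigma> \<tau> = (\<integral>x. (F (\<sigma> x) - F (\<tau> x))\<^sup>2 \<partial>M)" for \<sigma> \<tau>
  have "0 \<le> (\<integral>x. (F x - F (S x) - F (T x) + F (S (T x)))\<^sup>2 \<partial>M)" by simp
  \<comment> \<open>The square of the mixed difference is the sum of the squares over the four sides
    of the square \<open>x, Sx, STx, Tx\<close> minus those over its two diagonals.\<close>
  also have "\<dots> = (\<integral>x. (F (S x) - F x)\<^sup>2 + (F (S (T x)) - F (T x))\<^sup>2 + (F (T x) - F x)\<^sup>2
      + (F (S (T x)) - F (S x))\<^sup>2 - (F (S (T x)) - F x)\<^sup>2 - (F (T x) - F (S x))\<^sup>2 \<partial>M)"
    by (intro Bochner_Integration.integral_cong refl) (simp add: power2_eq_square algebra_simps)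
  also have "\<dots> = d S (\<lambda>x. x) + d (\<lambda>x. S (T x)) T + d T (\<lambda>x. x)
      + d (\<lambda>x. S (T x)) S - d (\<lambda>x. S (T x)) (\<lambda>x. x) - d T S"
    unfolding d_def using int[OF S(1) ids(1)] int[OF ids(2) T(1)] int[OF T(1) ids(1)]
      int[OF ids(2) S(1)] int[OF ids(2) ids(1)] int[OF T(1) S(1)] by simp
  \<comment> \<open>Invariance under \<open>T\<close> and \<open>S\<close> identifies opposite
    sides; invariance under the involution \<open>S\<close> identifies the diagonals.\<close>
  also have "d (\<lambda>x. S (T x)) T = d S (\<lambda>x. x)"
    unfolding d_def by (rule shift[OF T]) measurable
  also have "d (\<lambda>x. S (T x)) S = d T (\<lambda>x. x)"
    unfolding d_def comm by (rule shift[OF S]) measurable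
  also have "d T S = d (\<lambda>x. S (T x)) (\<lambda>x. x)"
    unfolding d_def using shift[OF S, of "\<lambda>x. (F (S (T x)) - F x)\<^sup>2"] by (simp add: comm inv)
  finally show ?thesis by (simp add: d_def)
qed

section \<open>Measure preserving actions on compact spaces\<close>

locale measured_action = irreducible_continuous_rank_ring +
  fixes \<phi> :: "'a \<Rightarrow> 'x::t2_space \<Rightarrow> 'x" and M :: "'x measure"
  assumes nondiscrete: "\<not> rank_discrete R rk"
    and compact: "compact (UNIV :: 'x set)"
    and action: "continuous_action (units_of R) (GL_topology R rk) \<phi>"
    and regular_measure: "regular_borel_prob M"
    and invariant: "invariant_measure (units_of R) \<phi> M"
begin

sublocale prob_space M
  using regular_measure by (simp add: regular_borel_prob_def)

lemma sets_M [measurable_cong]: "sets M = sets borel"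
  using regular_measure by (simp add: regular_borel_prob_def)

lemma space_M: "space M = UNIV"
  using sets_M sets_eq_imp_space_eq by fastforce

lemma action_mult: "\<lbrakk>u \<in> Units R; v \<in> Units R\<rbrakk> \<Longrightarrow> \<phi> (u \<otimes> v) x = \<phi> u (\<phi> v x)"
  using action group_action.composition_rule[of "units_of R" UNIV \<phi> x u v]
  by (simp add: continuous_action_def units_of_carrier units_of_mult)

lemma action_one: "\<phi> \<one> x = x"
  using action group_action.id_eq_one[of "units_of R" UNIV \<phi>]
  by (simp add: continuous_action_def units_of_one) (metis UNIV_I restrict_apply)

lemma action_measurable: "u \<in> Units R \<Longrightarrow> \<phi> u \<in> measurable M M"
  and action_invariant: "u \<in> Units R \<Longrightarrow> distr M M (\<phi> u) = M"
  using invariant by (auto simp: invariant_measure_def units_of_carrier)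

lemma topspace_GL: "topspace (GL_topology R rk) = Units R"
  by (auto simp: GL_topology_def rank_topology_def Units_def)

lemma action_continuous:
  assumes u: "u \<in> Units R"
  shows "continuous_on UNIV (\<phi> u)"
proof -
  have "continuous_map euclidean (prod_topology (GL_topology R rk) euclidean) (\<lambda>x::'x. (u, x))"
    using u by (intro continuous_map_pairedI) (auto simp: topspace_GL)
  then have "continuous_map euclidean euclidean ((\<lambda>(g, x). \<phi> g x) \<circ> (\<lambda>x. (u, x)))"
    using action unfolding continuous_action_def by (blast intro: continuous_map_compose)
  then show ?thesis by (simp add: o_def)
qed

text \<open>The tube lemma: by compactness, one neighbourhood of 1 serves all points at
  once.\<close>

lemma uniformly_near_one:
  fixes f :: "'x \<Rightarrow> real"
  assumes f: "continuous_on UNIV f" and \<epsilon>: "0 < \<epsilon>"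
  obtains \<delta> where "0 < \<delta>" "\<forall>u\<in>Units R. rk (u \<ominus> \<one>) < \<delta> \<longrightarrow> (\<forall>x. \<bar>f (\<phi> u x) - f x\<bar> < \<epsilon>)"
proof -
  let ?P = "prod_topology (GL_topology R rk) (euclidean :: 'x topology)"
  have "continuous_map ?P euclidean (f \<circ> (\<lambda>(g, x). \<phi> g x))"
    using action f unfolding continuous_action_def by (intro continuous_map_compose) auto
  moreover have "continuous_map ?P euclidean (f \<circ> snd)"
    using f by (intro continuous_map_compose[OF continuous_map_snd]) simp
  ultimately have "continuous_map ?P euclidean (\<lambda>z. \<bar>(f \<circ> (\<lambda>(g, x). \<phi> g x)) z - (f \<circ> snd) z\<bar>)"
    by (intro continuous_map_real_abs continuous_map_diff)
  then have W: "openin ?P {z \<in> topspace ?P. \<bar>(f \<circ> (\<lambda>(g, x). \<phi> g x)) z - (f \<circ> snd) z\<bar> \<in> {..<\<epsilon>}}"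
    by (rule openin_continuous_map_preimage) (simp flip: open_openin)
  have "\<exists>U V. openin (GL_topology R rk) U \<and> openin euclidean V \<and> \<one> \<in> U \<and> UNIV \<subseteq> V
      \<and> U \<times> V \<subseteq> {z \<in> topspace ?P. \<bar>(f \<circ> (\<lambda>(g, x). \<phi> g x)) z - (f \<circ> snd) z\<bar> \<in> {..<\<epsilon>}}"
    by (rule tube_lemma_right[OF W])
       (use compact \<epsilon> in \<open>auto simp: compactin_euclidean_iff topspace_GL action_one\<close>)
  then obtain U where U: "openin (GL_topology R rk) U" "\<one> \<in> U"
    "\<And>u x. u \<in> U \<Longrightarrow> \<bar>f (\<phi> u x) - f x\<bar> < \<epsilon>" by fastforce
  obtain O' where O': "openin rank.mtopology O'" "U = O' \<inter> Units R"
    using U(1) by (auto simp: GL_topology_def rank_topology_def openin_subtopology)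
  then obtain \<delta> where \<delta>: "0 < \<delta>" "rank.mball \<one> \<delta> \<subseteq> O'"
    using U(2) rank.openin_mtopology by auto
  have "u \<in> U" if "u \<in> Units R" "rk (u \<ominus> \<one>) < \<delta>" for u
  proof -
    have "u \<in> carrier R" using that(1) by auto
    then have "rank_dist R rk \<one> u < \<delta>"
      using that(2) rank.commute[of \<one> u] by (simp add: rank_dist_def)
    then show ?thesis using \<delta>(2) O'(2) that(1) \<open>u \<in> carrier R\<close> by auto
  qed
  then show ?thesis using that[OF \<delta>(1)] U(3) by blast
qed

section \<open>Regularised functions and their energy\<close>

text \<open>
  Lipschitz regularisation along orbits. As an infimum of continuous functions it is only upper
  semicontinuous, but this is enough for measurability.
\<close>
definition lip_approx :: "('x \<Rightarrow> real) \<Rightarrow> real \<Rightarrow> 'x \<Rightarrow> real" where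
  "lip_approx f L x = (INF h\<in>Units R. f (\<phi> h x) + L * rk (h \<ominus> \<one>))"

context
  fixes f :: "'x \<Rightarrow> real" and L :: real
  assumes f: "continuous_on UNIV f" "\<And>x. 0 \<le> f x" "\<And>x. f x \<le> 1" and L: "0 \<le> L"
begin

lemma lip_terms_nonneg: "h \<in> Units R \<Longrightarrow> 0 \<le> f (\<phi> h x) + L * rk (h \<ominus> \<one>)"
  using f(2) L rk_nonneg[of "h \<ominus> \<one>"] by (auto intro!: add_nonneg_nonneg mult_nonneg_nonneg)

lemma lip_terms_bdd: "bdd_below ((\<lambda>h. f (\<phi> h x) + L * rk (h \<ominus> \<one>)) ` Units R)"
  using lip_terms_nonneg by (auto intro!: bdd_belowI2)

lemma lip_approx_le: "h \<in> Units R \<Longrightarrow> lip_approx f L x \<le> f (\<phi> h x) + L * rk (h \<ominus> \<one>)"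
  unfolding lip_approx_def by (rule cINF_lower[OF lip_terms_bdd])

lemma lip_approx_greatest:
  "(\<And>h. h \<in> Units R \<Longrightarrow> c \<le> f (\<phi> h x) + L * rk (h \<ominus> \<one>)) \<Longrightarrow> c \<le> lip_approx f L x"
  unfolding lip_approx_def by (rule cINF_greatest) auto

lemma lip_approx_le_self: "lip_approx f L x \<le> f x"
  using lip_approx_le[of \<one> x] by (simp add: action_one minus_eq r_neg rk_zero)

lemma lip_approx_bounded: "\<bar>lip_approx f L x\<bar> \<le> 1"
  using lip_approx_greatest[of 0 x] lip_terms_nonneg lip_approx_le_self[of x] f(3)[of x] by fastforce

lemma lip_approx_measurable: "lip_approx f L \<in> borel_measurable M"
  unfolding borel_measurable_iff_less
proof
  fix a
  have "{x. lip_approx f L x < a} = (\<Union>h\<in>Units R. {x. f (\<phi> h x) + L * rk (h \<ominus> \<one>) < a})"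
    unfolding lip_approx_def by (subst cINF_less_iff[OF _ lip_terms_bdd]) auto
  moreover have "open {x. f (\<phi> h x) + L * rk (h \<ominus> \<one>) < a}" if "h \<in> Units R" for h
    by (intro open_Collect_less continuous_intros continuous_on_compose2[OF f(1) action_continuous[OF that]]) auto
  ultimately have "open {x. lip_approx f L x < a}" by auto
  then show "{x \<in> space M. lip_approx f L x < a} \<in> sets M" by (simp add: sets_M space_M)
qed

text \<open>Every \<open>h\<close> in the infimum at \<open>x\<close> is compared with
  \<open>k = h \<otimes> inv u\<close> in the infimum at \<open>\<phi> u x\<close>: both reach the
  same point, and \<open>k - 1 = (h - u) u^-1\<close> has rank at most
  \<open>rk (h - u)\<close>.\<close>

lemma lip_approx_lipschitz:
  assumes u: "u \<in> Units R"
  shows "lip_approx f L (\<phi> u x) \<le> lip_approx f L x + L * rk (u \<ominus> \<one>)"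
proof -
  have "lip_approx f L (\<phi> u x) - L * rk (u \<ominus> \<one>) \<le> f (\<phi> h x) + L * rk (h \<ominus> \<one>)" if h: "h \<in> Units R" for h
  proof -
    define k where "k = h \<otimes> inv u"
    have [simp]: "u \<in> carrier R" "h \<in> carrier R" "inv u \<in> carrier R" "k \<in> Units R" "k \<in> carrier R"
      using u h by (auto simp: k_def)
    have "k \<otimes> u = h" using u by (simp add: k_def m_assoc)
    then have "\<phi> k (\<phi> u x) = \<phi> h x" using action_mult[of k u x] u by simp
    then have "lip_approx f L (\<phi> u x) \<le> f (\<phi> h x) + L * rk (k \<ominus> \<one>)"
      using lip_approx_le[of k "\<phi> u x"] by simp
    moreover have "k \<ominus> \<one> = (h \<ominus> u) \<otimes> inv u"
      using u by (simp add: k_def minus_eq l_distr l_minus)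
    then have "rk (k \<ominus> \<one>) \<le> rk (h \<ominus> u)" using rk_mult_left[of "h \<ominus> u" "inv u"] by simp
    moreover have "rk (h \<ominus> u) \<le> rk (h \<ominus> \<one>) + rk (u \<ominus> \<one>)"
      using rank.triangle[of h \<one> u] rank.commute[of u \<one>] by (simp add: rank_dist_def)
    ultimately show ?thesis
      using mult_left_mono[OF _ L, of "rk (k \<ominus> \<one>)" "rk (h \<ominus> \<one>) + rk (u \<ominus> \<one>)"] by (simp add: algebra_simps)
  qed
  then have "lip_approx f L (\<phi> u x) - L * rk (u \<ominus> \<one>) \<le> lip_approx f L x" by (rule lip_approx_greatest)
  then show ?thesis by simp
qed

text \<open>Since \<open>u\<close> interchanges \<open>x\<close> and \<open>\<phi> u x\<close>, the
  one-sided estimate at these two points bounds both signs.\<close>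

lemma lip_approx_involution:
  assumes u: "u \<in> Units R" "u \<otimes> u = \<one>"
  shows "\<bar>lip_approx f L (\<phi> u x) - lip_approx f L x\<bar> \<le> L * rk (u \<ominus> \<one>)"
  using lip_approx_lipschitz[OF u(1), of x] lip_approx_lipschitz[OF u(1), of "\<phi> u x"]
    action_mult[OF u(1) u(1), of x] by (simp add: u(2) action_one abs_le_iff)

definition energy :: "'a \<Rightarrow> real" where
  "energy u = (\<integral>x. (lip_approx f L (\<phi> u x) - lip_approx f L x)\<^sup>2 \<partial>M)"

lemma energy_integrable:
  assumes u: "u \<in> Units R"
  shows "integrable M (\<lambda>x. (lip_approx f L (\<phi> u x) - lip_approx f L x)\<^sup>2)"
proof (rule integrable_const_bound[where B = 4])
  have "(lip_approx f L (\<phi> u x) - lip_approx f L x)\<^sup>2 \<le> 2\<^sup>2" for x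
    using lip_approx_bounded[of x] lip_approx_bounded[of "\<phi> u x"]
    by (intro power2_le_iff_abs_le[THEN iffD2]) auto
  then show "AE x in M. norm ((lip_approx f L (\<phi> u x) - lip_approx f L x)\<^sup>2) \<le> 4" by simp
  note [measurable] = lip_approx_measurable action_measurable[OF u]
  show "(\<lambda>x. (lip_approx f L (\<phi> u x) - lip_approx f L x)\<^sup>2) \<in> borel_measurable M" by measurable
qed

lemma energy_le_rank:
  assumes u: "u \<in> Units R" "u \<otimes> u = \<one>"
  shows "energy u \<le> (L * rk (u \<ominus> \<one>))\<^sup>2"
proof -
  have "(lip_approx f L (\<phi> u x) - lip_approx f L x)\<^sup>2 \<le> (L * rk (u \<ominus> \<one>))\<^sup>2" for x
    using lip_approx_involution[OF u, of x] by (metis abs_ge_zero power2_abs power_mono)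
  then show ?thesis
    unfolding energy_def using energy_integrable[OF u(1)]
    by (intro integral_le_const AE_I2) auto
qed

lemma energy_mult:
  assumes u: "u \<in> Units R" and v: "v \<in> Units R" and inv: "u \<otimes> u = \<one>" and comm: "u \<otimes> v = v \<otimes> u"
  shows "energy (u \<otimes> v) \<le> energy u + energy v"
proof -
  have "\<phi> u (\<phi> v x) = \<phi> v (\<phi> u x)" for x
    using action_mult[OF u v, of x] action_mult[OF v u, of x] comm by simp
  moreover have "\<phi> u (\<phi> u x) = x" for x
    using action_mult[OF u u, of x] inv by (simp add: action_one)
  ultimately show ?thesis
    unfolding energy_def action_mult[OF u v]
    by (intro commuting_involutions_energy[where B = 1] finite_measure_axioms action_measurable
        action_invariant lip_approx_measurable lip_approx_bounded u v)
qed

end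

text \<open>Idempotents of rank \<open>rk a\<close> are split off until the rest has rank at most
  \<open>2 rk a\<close>, below which \<open>subidem_of_rank\<close> is no longer available. Each
  piece costs at most \<open>L\<^sup>2\<close> times its squared rank, and its rank is at most
  \<open>2 rk a\<close>.\<close>

lemma energy_split_involution_le:
  fixes f :: "'x \<Rightarrow> real"
  assumes f: "continuous_on UNIV f" "\<And>x. 0 \<le> f x" "\<And>x. f x \<le> 1" and L: "0 \<le> L"
    and a: "idem a" "0 < rk a"
    and e: "idem e" "y \<in> carrier R" "e \<otimes> y \<otimes> e = e \<oplus> e" "rk e \<le> real n * rk a"
  shows "energy f L (\<one> \<ominus> y \<otimes> e) \<le> L\<^sup>2 * (2 * rk a) * rk e"
  using e
proof (induction n arbitrary: e)
  have base: "energy f L (\<one> \<ominus> y \<otimes> e) \<le> L\<^sup>2 * (2 * rk a) * rk e"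
    if e: "idem e" "e \<otimes> y \<otimes> e = e \<oplus> e" "rk e \<le> 2 * rk a" for e
  proof -
    note inv = split_involution[OF e(1) \<open>y \<in> carrier R\<close> e(2)]
    have ey: "e \<in> carrier R" "y \<in> carrier R" using e assms by auto
    have "energy f L (\<one> \<ominus> y \<otimes> e) \<le> (L * rk (\<one> \<ominus> y \<otimes> e \<ominus> \<one>))\<^sup>2"
      using energy_le_rank[OF f L inv(2,1)] .
    also have "\<dots> \<le> (L * rk e)\<^sup>2"
      using inv(3) L ey by (intro power_mono mult_left_mono mult_nonneg_nonneg rk_nonneg) auto
    also have "\<dots> = L\<^sup>2 * rk e * rk e" by (simp add: power2_eq_square)
    also have "\<dots> \<le> L\<^sup>2 * (2 * rk a) * rk e"
      using e(3) rk_nonneg[OF ey(1)] by (intro mult_right_mono mult_left_mono) auto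
    finally show ?thesis .
  qed
  {
    case 0
    then show ?case using base[of e] a by simp
  next
    case (Suc n)
    show ?case
    proof (cases "rk e \<le> 2 * rk a")
      case True
      then show ?thesis using base Suc.prems by simp
    next
      case False
      have [simp]: "e \<in> carrier R" "e \<otimes> e = e" using Suc.prems by auto
      obtain d where d: "idem d" "e \<otimes> d = d" "d \<otimes> e = d" "rk d = rk a"
        using subidem_of_rank[OF a(1) Suc.prems(1)] False by auto
      have [simp]: "d \<in> carrier R" "d \<otimes> d = d" using d by auto
      define c where "c = e \<ominus> d"
      have c: "idem c" "d \<otimes> c = \<zero>" "c \<otimes> d = \<zero>" by (simp_all add: c_def idem_def expand d)
      have [simp]: "c \<in> carrier R" using c by auto
      have e_eq: "e = d \<oplus> c" by (simp add: c_def expand)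
      then have "rk e = rk a + rk c" using rk_orthogonal[OF d(1) c] d(4) by simp
      \<comment> \<open>Both factors keep the same \<open>y\<close>, so they are again involutions
        of the required form, and they commute.\<close>
      note split = split_involution_add[OF d(1) c(1) Suc.prems(2) c(2,3) Suc.prems(3)[unfolded e_eq]]
      note invd = split_involution[OF d(1) Suc.prems(2) split(1)]
      note invc = split_involution[OF c(1) Suc.prems(2) split(2)]
      have "energy f L (\<one> \<ominus> y \<otimes> e) \<le> energy f L (\<one> \<ominus> y \<otimes> d) + energy f L (\<one> \<ominus> y \<otimes> c)"
        using energy_mult[OF f L invd(2) invc(2) invd(1)] split(3,4) e_eq by simp
      also have "energy f L (\<one> \<ominus> y \<otimes> d) \<le> L\<^sup>2 * (2 * rk a) * rk d"
        by (rule base) (use d split a in auto)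
      also have "energy f L (\<one> \<ominus> y \<otimes> c) \<le> L\<^sup>2 * (2 * rk a) * rk c"
        by (rule Suc.IH) (use c Suc.prems split \<open>rk e = rk a + rk c\<close> in \<open>auto simp: algebra_simps\<close>)
      finally show ?thesis using \<open>rk e = rk a + rk c\<close> d(4) by (simp add: algebra_simps)
    qed
  }
qed

lemma energy_split_involution:
  fixes f :: "'x \<Rightarrow> real"
  assumes f: "continuous_on UNIV f" "\<And>x. 0 \<le> f x" "\<And>x. f x \<le> 1" and L: "0 \<le> L"
    and e: "idem e" "y \<in> carrier R" "e \<otimes> y \<otimes> e = e \<oplus> e"
  shows "energy f L (\<one> \<ominus> y \<otimes> e) = 0"
proof -
  have eR: "e \<in> carrier R" using e by auto
  have "energy f L (\<one> \<ominus> y \<otimes> e) \<le> 0 + \<epsilon>" if \<epsilon>: "0 < \<epsilon>" for \<epsilon>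
  proof -
    \<comment> \<open>The summand 1 keeps the denominator positive when
      \<open>L = 0\<close>.\<close>
    obtain a where a: "idem a" "0 < rk a" "rk a < \<epsilon> / (2 * L\<^sup>2 + 1)"
      using small_idem[OF nondiscrete, of "\<epsilon> / (2 * L\<^sup>2 + 1)"] \<epsilon> by (auto simp: add_nonneg_pos)
    obtain n where "1 / rk a \<le> real n" using real_arch_simple by blast
    then have "rk e \<le> real n * rk a" using a(2) rk_le_1[OF eR] by (simp add: field_simps)
    then have "energy f L (\<one> \<ominus> y \<otimes> e) \<le> L\<^sup>2 * (2 * rk a) * rk e"
      using energy_split_involution_le[OF f L a(1,2) e] by simp
    also have "\<dots> \<le> L\<^sup>2 * (2 * rk a) * 1"
      using rk_le_1[OF eR] a by (intro mult_left_mono) auto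
    also have "\<dots> \<le> (2 * L\<^sup>2 + 1) * rk a" using a by (simp add: algebra_simps)
    also have "\<dots> \<le> \<epsilon>"
      using a(3) by (simp add: pos_less_divide_eq add_nonneg_pos mult.commute)
    finally show ?thesis by simp
  qed
  then have "energy f L (\<one> \<ominus> y \<otimes> e) \<le> 0" by (rule field_le_epsilon)
  moreover have "0 \<le> energy f L (\<one> \<ominus> y \<otimes> e)" unfolding energy_def[OF f L] by simp
  ultimately show ?thesis by simp
qed

text \<open>With \<open>L = 1 / \<delta>\<close>, elements \<open>h\<close> within \<delta> of 1
  change \<open>f\<close> by less than \<epsilon>, while all others incur a penalty of at least 1,
  an upper bound of \<open>f\<close>.\<close>

lemma lip_approx_close:
  fixes f :: "'x \<Rightarrow> real"
  assumes f: "continuous_on UNIV f" "\<And>x. 0 \<le> f x" "\<And>x. f x \<le> 1" and \<epsilon>: "0 < \<epsilon>"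
  obtains L where "0 \<le> L" "\<And>x. \<bar>lip_approx f L x - f x\<bar> \<le> \<epsilon>"
proof -
  obtain \<delta> where \<delta>: "0 < \<delta>" "\<forall>u\<in>Units R. rk (u \<ominus> \<one>) < \<delta> \<longrightarrow> (\<forall>x. \<bar>f (\<phi> u x) - f x\<bar> < \<epsilon>)"
    using uniformly_near_one[OF f(1) \<epsilon>] by blast
  have L: "0 \<le> 1 / \<delta>" using \<delta> by simp
  have "f x - \<epsilon> \<le> lip_approx f (1 / \<delta>) x" for x
  proof (rule lip_approx_greatest[OF f L])
    fix h assume h: "h \<in> Units R"
    then have hR: "h \<ominus> \<one> \<in> carrier R" by auto
    show "f x - \<epsilon> \<le> f (\<phi> h x) + 1 / \<delta> * rk (h \<ominus> \<one>)"
    proof (cases "rk (h \<ominus> \<one>) < \<delta>")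
      case True
      then have "\<bar>f (\<phi> h x) - f x\<bar> < \<epsilon>" using \<delta> h by blast
      moreover have "0 \<le> 1 / \<delta> * rk (h \<ominus> \<one>)" using L rk_nonneg[OF hR] by simp
      ultimately show ?thesis by linarith
    next
      case False
      then have "1 \<le> 1 / \<delta> * rk (h \<ominus> \<one>)" using \<delta>(1) by (simp add: field_simps)
      then show ?thesis using f(2)[of "\<phi> h x"] f(3)[of x] \<epsilon> by linarith
    qed
  qed
  then have "\<bar>lip_approx f (1 / \<delta>) x - f x\<bar> \<le> \<epsilon>" for x
    using lip_approx_le_self[OF f L, of x] \<epsilon> by (simp add: abs_le_iff algebra_simps)
  then show ?thesis using that L by blast
qed

section \<open>Fixed points in the support\<close>

lemma split_involution_fixes:
  assumes e: "idem e" "y \<in> carrier R" "e \<otimes> y \<otimes> e = e \<oplus> e" and x: "x \<in> measure_support M"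
  shows "\<phi> (\<one> \<ominus> y \<otimes> e) x = x"
proof (rule ccontr)
  define t where "t = \<one> \<ominus> y \<otimes> e"
  have t: "t \<in> Units R" using split_involution[OF e] by (simp add: t_def)
  assume "\<phi> (\<one> \<ominus> y \<otimes> e) x \<noteq> x"
  then obtain f :: "'x \<Rightarrow> real"
    where f: "continuous_on UNIV f" "\<And>z. 0 \<le> f z" "\<And>z. f z \<le> 1" "f (\<phi> t x) \<noteq> f x"
    using compact_separation[OF compact] by (metis t_def)
  \<comment> \<open>At \<open>x\<close> the values differ by \<open>3\<epsilon>\<close>. Zero energy
    makes the regularised function invariant almost everywhere, so approximation within \<epsilon>
    leaves a difference of at most \<open>2\<epsilon>\<close> for \<open>f\<close>; this must fail
    on a neighbourhood of \<open>x\<close>, which has positive measure.\<close>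
  define \<epsilon> where "\<epsilon> = \<bar>f (\<phi> t x) - f x\<bar> / 3"
  have "0 < \<epsilon>" using f(4) by (simp add: \<epsilon>_def)
  obtain L where L: "0 \<le> L" "\<And>x. \<bar>lip_approx f L x - f x\<bar> \<le> \<epsilon>"
    using lip_approx_close[OF f(1-3) \<open>0 < \<epsilon>\<close>] by blast
  have "energy f L t = 0" using energy_split_involution[OF f(1-3) L(1) e] by (simp add: t_def)
  then have "AE z in M. (lip_approx f L (\<phi> t z) - lip_approx f L z)\<^sup>2 = 0"
    using energy_integrable[OF f(1-3) L(1) t]
    unfolding energy_def[OF f(1-3) L(1)] by (subst (asm) integral_nonneg_eq_0_iff_AE) auto
  then have small: "AE z in M. \<not> 2 * \<epsilon> < \<bar>f (\<phi> t z) - f z\<bar>"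
  proof (rule AE_mp, intro AE_I2 impI)
    fix z assume "(lip_approx f L (\<phi> t z) - lip_approx f L z)\<^sup>2 = 0"
    then show "\<not> 2 * \<epsilon> < \<bar>f (\<phi> t z) - f z\<bar>" using L(2)[of z] L(2)[of "\<phi> t z"] by simp
  qed
  define U where "U = {z. 2 * \<epsilon> < \<bar>f (\<phi> t z) - f z\<bar>}"
  have "open U" unfolding U_def
    by (intro open_Collect_less continuous_intros f(1) continuous_on_compose2[OF f(1) action_continuous[OF t]]) auto
  moreover have "x \<in> U" using \<open>0 < \<epsilon>\<close> by (auto simp: U_def \<epsilon>_def)
  ultimately have "0 < emeasure M U" using x by (auto simp: measure_support_def)
  moreover have "emeasure M U = 0"
    using small \<open>open U\<close> AE_iff_measurable[of U M "\<lambda>z. \<not> 2 * \<epsilon> < \<bar>f (\<phi> t z) - f z\<bar>"]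
    by (simp add: U_def sets_M space_M)
  ultimately show False by simp
qed

text \<open>Density and continuity: \<open>g = wu\<close>, where \<open>u\<close> fixes
  \<open>x\<close> and \<open>w\<close> is so close to 1 that it changes \<open>f\<close> by less
  than \<open>\<bar>f (\<phi> g x) - f x\<bar>\<close>.\<close>

lemma support_fixed:
  assumes g: "g \<in> Units R" and x: "x \<in> measure_support M"
  shows "\<phi> g x = x"
proof (rule ccontr)
  define N where "N = {u \<in> Units R. \<forall>x\<in>measure_support M. \<phi> u x = x}"
  interpret N: split_involution_group R rk N
    by unfold_locales
       (auto simp: N_def action_one action_mult split_involution_fixes split_involution(2))
  assume "\<phi> g x \<noteq> x"
  then obtain f :: "'x \<Rightarrow> real" where f: "continuous_on UNIV f" "f (\<phi> g x) \<noteq> f x"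
    using compact_separation[OF compact] by metis
  obtain \<delta> where \<delta>: "0 < \<delta>"
    "\<forall>u\<in>Units R. rk (u \<ominus> \<one>) < \<delta> \<longrightarrow> (\<forall>z. \<bar>f (\<phi> u z) - f z\<bar> < \<bar>f (\<phi> g x) - f x\<bar>)"
    using uniformly_near_one[OF f(1), of "\<bar>f (\<phi> g x) - f x\<bar>"] f(2) by auto
  \<comment> \<open>Approximating at \<open>inv g\<close> makes \<open>u \<otimes> inv g\<close>,
    the inverse of \<open>w\<close>, close to 1; hence so is \<open>w\<close>.\<close>
  obtain u where u: "u \<in> N" "rk (u \<otimes> inv g \<ominus> \<one>) < \<delta>"
    using N.approximation[OF nondiscrete Units_inv_Units[OF g] \<delta>(1)] .
  have uU: "u \<in> Units R" "\<phi> u x = x" using u(1) x by (auto simp: N_def)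
  define w where "w = g \<otimes> inv u"
  have w: "w \<in> Units R" using g uU by (simp add: w_def)
  have [simp]: "g \<in> carrier R" "u \<in> carrier R" "inv u \<in> carrier R" "inv g \<in> carrier R" "w \<in> carrier R"
    using g uU w by auto
  have "w \<otimes> (u \<otimes> inv g) = \<one>" using g uU by (simp add: w_def m_assoc) (simp add: m_assoc[symmetric])
  then have "w \<ominus> \<one> = \<ominus> (w \<otimes> (u \<otimes> inv g \<ominus> \<one>))" by (simp add: minus_eq r_distr r_minus minus_add a_comm)
  then have "rk (w \<ominus> \<one>) \<le> rk (u \<otimes> inv g \<ominus> \<one>)"
    using rk_minus rk_mult_right[of w "u \<otimes> inv g \<ominus> \<one>"] by simp
  then have "\<bar>f (\<phi> w x) - f x\<bar> < \<bar>f (\<phi> g x) - f x\<bar>" using \<delta>(2) w u(2) by simp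
  moreover have "w \<otimes> u = g" using uU by (simp add: w_def m_assoc)
  then have "\<phi> w x = \<phi> g x" using action_mult[OF w uU(1), of x] uU(2) by simp
  ultimately show False by simp
qed

end

theorem corollary1p2:
  fixes R :: "('a, 'b) ring_scheme"
    and rk :: "'a \<Rightarrow> real"
    and \<phi> :: "'a \<Rightarrow> 'x::t2_space \<Rightarrow> 'x"
    and M :: "'x measure"
  assumes "irreducible_ring R"
    and "continuous_ring R"
    and "rank_function R rk"
    and "\<not> rank_discrete R rk"
    and "compact (UNIV :: 'x set)"
    and "continuous_action (units_of R) (GL_topology R rk) \<phi>"
    and "regular_borel_prob M"
    and "invariant_measure (units_of R) \<phi> M"
  shows "measure_support M \<subseteq> fixed_points (units_of R) \<phi>"
proof -
  have reg: "regular_ring R" using assms(2) by (simp add: continuous_ring_def)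
  interpret ring R using reg by (simp add: regular_ring_def)
  interpret measured_action R rk \<phi> M
    by unfold_locales (use assms reg in \<open>auto simp: regular_ring_def\<close>)
  show ?thesis using support_fixed by (auto simp: fixed_points_def units_of_carrier)
qed

end
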